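(* Let $\lambda,q\in\mathbf{k}$ and let $(A,d_0)$ be a commutative differential $\mathbf{k}$-algebra of weight $\lambda$, and let $j_A:A\hookrightarrow T^+(A)$ be the natural embedding $A=A^{\otimes1}\subseteq T^+(A)$. Then $(T^+(A),\prec_A,\succ_A,\bullet_A,d_A)$ together with $j_A$ is the free commutative differential $q$-tridendriform algebra of weight $\lambda$ on $(A,d_0)$: for every commutative differential $q$-tridendriform algebra $(T,\prec_T,\succ_T,\bullet_T,d_T)$ of weight $\lambda$ and every linear map $\psi:A\to T$ with $\psi(ab)=\psi(a)\bullet_T\psi(b)$ for all $a,b\in A$ and $d_T\psi=\psi d_0$, there is a unique linear map $\bar\psi:T^+(A)\to T$ preserving $\prec,\succ,\bullet$ (i.e. $\bar\psi(\mathfrak a\ast_A\mathfrak b)=\bar\psi(\mathfrak a)\ast_T\bar\psi(\mathfrak b)$ for $\ast\in\{\prec,\succ,\bullet\}$), satisfying $d_T\bar\psi=\bar\psi d_A$, and with $\bar\psi j_A=\psi$.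
   Context: $\mathbf{k}$ is a commutative unital ring. A commutative differential algebra of weight $\lambda$ is a commutative associative algebra $A$ with a linear map $d_0$ such that $d_0(ab)=d_0(a)b+ad_0(b)+\lambda d_0(a)d_0(b)$. Let $T(A)=\bigoplus_{k\ge0}A^{\otimes k}$ (with $A^{\otimes 0}=\mathbf{k}$, whose unit $\mathbf 1$ is the empty tensor) and $T^+(A)=\bigoplus_{k\ge1}A^{\otimes k}$. The quasi-shuffle product $\ast_q$ of weight $q$ on $T(A)$ is defined recursively by $\mathbf 1\ast_q\mathfrak a=\mathfrak a\ast_q\mathbf 1=\mathfrak a$ and, for pure tensors $\mathfrak a=a_1\otimes\mathfrak a'$, $\mathfrak b=b_1\otimes\mathfrak b'$ with $a_1,b_1\in A$, $\mathfrak a\ast_q\mathfrak b=a_1\otimes(\mathfrak a'\ast_q\mathfrak b)+b_1\otimes(\mathfrak a\ast_q\mathfrak b')+q(a_1b_1)\otimes(\mathfrak a'\ast_q\mathfrak b')$, extended bilinearly. On $T^+(A)$ define bilinear operations on pure tensors by $\mathfrak a\prec_A\mathfrak b:=a_1\otimes(\mathfrak a'\ast_q\mathfrak b)$, $\mathfrak a\succ_A\mathfrak b:=b_1\otimes(\mathfrak a\ast_q\mathfrak b')$, $\mathfrak a\bullet_A\mathfrak b:=(a_1b_1)\otimes(\mathfrak a'\ast_q\mathfrak b')$. Define the linear map $d_A:T^+(A)\to T^+(A)$ by $d_A(a_1\otimes\cdots\otimes a_m)=\sum_{\emptyset\ne S\subseteq\{1,\dots,m\}}\lambda^{|S|-1}\,c^S_1\otimes\cdots\otimes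 c^S_m$, where $c^S_i=d_0(a_i)$ if $i\in S$ and $c^S_i=a_i$ otherwise (in particular $d_A(a_1)=d_0(a_1)$). For $q\in\mathbf{k}$, a $q$-tridendriform algebra is a $\mathbf{k}$-module $T$ with bilinear operations $\prec,\succ,\bullet$ such that, writing $\star_q:=\prec+\succ+q\bullet$, for all $a,b,c\in T$: $(a\prec b)\prec c=a\prec(b\star_q c)$, $(a\succ b)\prec c=a\succ(b\prec c)$, $(a\star_q b)\succ c=a\succ(b\succ c)$, $(a\succ b)\bullet c=a\succ(b\bullet c)$, $(a\prec b)\bullet c=a\bullet(b\succ c)$, $(a\bullet b)\prec c=a\bullet(b\prec c)$, $(a\bullet b)\bullet c=a\bullet(b\bullet c)$. It is commutative if $a\succ b=b\prec a$ and $a\bullet b=b\bullet a$ for all $a,b$. A derivation of weight $\lambda$ on it is a linear map $d$ with $d(a\ast b)=d(a)\ast b+a\ast d(b)+\lambda d(a)\ast d(b)$ for each $\ast\in\{\prec,\succ,\bullet\}$ and all $a,b$; then $(T,\prec,\succ,\bullet,d)$ is a differential $q$-tridendriform algebra of weight $\lambda$, called commutative if $(T,\prec,\succ,\bullet)$ is commutative. *)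

theory Defs
  imports Complex_Main "HOL-Library.Function_Algebras"
begin

definition comm_diff_alg :: "('k::comm_ring_1 \<Rightarrow> 'a::comm_ring \<Rightarrow> 'a) \<Rightarrow> 'k \<Rightarrow> ('a \<Rightarrow> 'a) \<Rightarrow> bool" where
  "comm_diff_alg sA lam d0 \<longleftrightarrow>
     module sA \<and>
     (\<forall>c a b. sA c (a * b) = sA c a * b) \<and>
     (\<forall>a b. d0 (a + b) = d0 a + d0 b) \<and>
     (\<forall>c a. d0 (sA c a) = sA c (d0 a)) \<and>
     (\<forall>a b. d0 (a * b) = d0 a * b + a * d0 b + sA lam (d0 a * d0 b))"

definition linear_on :: "'t set \<Rightarrow> ('t \<Rightarrow> 't \<Rightarrow> 't) \<Rightarrow> ('k \<Rightarrow> 't \<Rightarrow> 't) \<Rightarrow> ('t \<Rightarrow> 't) \<Rightarrow> bool" where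
  "linear_on C add sc f \<longleftrightarrow>
     (\<forall>x\<in>C. f x \<in> C) \<and>
     (\<forall>x\<in>C. \<forall>y\<in>C. f (add x y) = add (f x) (f y)) \<and>
     (\<forall>c. \<forall>x\<in>C. f (sc c x) = sc c (f x))"

definition bilinear_on :: "'t set \<Rightarrow> ('t \<Rightarrow> 't \<Rightarrow> 't) \<Rightarrow> ('k \<Rightarrow> 't \<Rightarrow> 't) \<Rightarrow> ('t \<Rightarrow> 't \<Rightarrow> 't) \<Rightarrow> bool" where
  "bilinear_on C add sc op \<longleftrightarrow>
     (\<forall>x\<in>C. \<forall>y\<in>C. op x y \<in> C) \<and>
     (\<forall>x\<in>C. \<forall>y\<in>C. \<forall>z\<in>C. op (add x y) z = add (op x z) (op y z) \<and> op x (add y z) = add (op x y) (op x z)) \<and>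
     (\<forall>c. \<forall>x\<in>C. \<forall>y\<in>C. op (sc c x) y = sc c (op x y) \<and> op x (sc c y) = sc c (op x y))"

definition tridend_on :: "'t set \<Rightarrow> ('t \<Rightarrow> 't \<Rightarrow> 't) \<Rightarrow> ('k \<Rightarrow> 't \<Rightarrow> 't) \<Rightarrow> 'k \<Rightarrow>
    ('t \<Rightarrow> 't \<Rightarrow> 't) \<Rightarrow> ('t \<Rightarrow> 't \<Rightarrow> 't) \<Rightarrow> ('t \<Rightarrow> 't \<Rightarrow> 't) \<Rightarrow> bool" where
  "tridend_on C add sc q pr su bu \<longleftrightarrow>
     bilinear_on C add sc pr \<and> bilinear_on C add sc su \<and> bilinear_on C add sc bu \<and>
     (let st = (\<lambda>x y. add (add (pr x y) (su x y)) (sc q (bu x y))) in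
      \<forall>a\<in>C. \<forall>b\<in>C. \<forall>c\<in>C.
        pr (pr a b) c = pr a (st b c) \<and>
        pr (su a b) c = su a (pr b c) \<and>
        su (st a b) c = su a (su b c) \<and>
        bu (su a b) c = su a (bu b c) \<and>
        bu (pr a b) c = bu a (su b c) \<and>
        pr (bu a b) c = bu a (pr b c) \<and>
        bu (bu a b) c = bu a (bu b c))"

definition comm_tridend_on where
  "comm_tridend_on C add sc q pr su bu \<longleftrightarrow>
     tridend_on C add sc q pr su bu \<and>
     (\<forall>a\<in>C. \<forall>b\<in>C. su a b = pr b a \<and> bu a b = bu b a)"

definition derivation_on :: "'t set \<Rightarrow> ('t \<Rightarrow> 't \<Rightarrow> 't) \<Rightarrow> ('k \<Rightarrow> 't \<Rightarrow> 't) \<Rightarrow> 'k \<Rightarrow>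
    ('t \<Rightarrow> 't \<Rightarrow> 't) \<Rightarrow> ('t \<Rightarrow> 't) \<Rightarrow> bool" where
  "derivation_on C add sc lam op d \<longleftrightarrow>
     (\<forall>a\<in>C. \<forall>b\<in>C. d (op a b) = add (add (op (d a) b) (op a (d b))) (sc lam (op (d a) (d b))))"

definition comm_diff_tridend_on where
  "comm_diff_tridend_on C add sc q lam pr su bu d \<longleftrightarrow>
     comm_tridend_on C add sc q pr su bu \<and>
     linear_on C add sc d \<and>
     derivation_on C add sc lam pr d \<and>
     derivation_on C add sc lam su d \<and>
     derivation_on C add sc lam bu d"

text \<open>Formal k-linear combinations of words over A are functions 'a list => 'k
(finitely supported).  The tensor module T^+(A) is the quotient of the free k-module
on nonempty words by the submodule generated by the multilinearity relations; it is
modelled as the set of cosets.\<close>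

definition fsupp :: "('a list \<Rightarrow> 'k::zero) \<Rightarrow> 'a list set" where
  "fsupp f = {xs. f xs \<noteq> 0}"

definition delta :: "'a list \<Rightarrow> 'a list \<Rightarrow> 'k::zero_neq_one" where
  "delta xs = (\<lambda>ys. if ys = xs then 1 else 0)"

definition fsc :: "'k::times \<Rightarrow> ('a list \<Rightarrow> 'k) \<Rightarrow> 'a list \<Rightarrow> 'k" where
  "fsc c f = (\<lambda>xs. c * f xs)"

text \<open>pcons a f: the linear map  w |-> a (x) w  applied to the combination f.\<close>
definition pcons :: "'a \<Rightarrow> ('a list \<Rightarrow> 'k::zero) \<Rightarrow> 'a list \<Rightarrow> 'k" where
  "pcons a f = (\<lambda>ys. case ys of [] \<Rightarrow> 0 | y # zs \<Rightarrow> (if y = a then f zs else 0))"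

fun qsh :: "('k::comm_ring_1 \<Rightarrow> 'a::times \<Rightarrow> 'a) \<Rightarrow> 'k \<Rightarrow> 'a list \<Rightarrow> 'a list \<Rightarrow> ('a list \<Rightarrow> 'k)" where
  "qsh sA q [] ys = delta ys"
| "qsh sA q (x # xs) [] = delta (x # xs)"
| "qsh sA q (x # xs) (y # ys) =
     pcons x (qsh sA q xs (y # ys)) + pcons y (qsh sA q (x # xs) ys) + pcons (sA q (x * y)) (qsh sA q xs ys)"

fun prec_w :: "('k::comm_ring_1 \<Rightarrow> 'a::times \<Rightarrow> 'a) \<Rightarrow> 'k \<Rightarrow> 'a list \<Rightarrow> 'a list \<Rightarrow> ('a list \<Rightarrow> 'k)" where
  "prec_w sA q (x # xs) ys = pcons x (qsh sA q xs ys)"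
| "prec_w sA q [] ys = 0"

fun succ_w :: "('k::comm_ring_1 \<Rightarrow> 'a::times \<Rightarrow> 'a) \<Rightarrow> 'k \<Rightarrow> 'a list \<Rightarrow> 'a list \<Rightarrow> ('a list \<Rightarrow> 'k)" where
  "succ_w sA q xs (y # ys) = pcons y (qsh sA q xs ys)"
| "succ_w sA q xs [] = 0"

fun bul_w :: "('k::comm_ring_1 \<Rightarrow> 'a::times \<Rightarrow> 'a) \<Rightarrow> 'k \<Rightarrow> 'a list \<Rightarrow> 'a list \<Rightarrow> ('a list \<Rightarrow> 'k)" where
  "bul_w sA q (x # xs) (y # ys) = pcons (x * y) (qsh sA q xs ys)"
| "bul_w sA q [] ys = 0"
| "bul_w sA q xs [] = 0"

definition d_w :: "'k::comm_ring_1 \<Rightarrow> ('a \<Rightarrow> 'a) \<Rightarrow> 'a list \<Rightarrow> ('a list \<Rightarrow> 'k)" where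
  "d_w lam d0 xs = (\<lambda>zs. \<Sum>S\<in>{S. S \<subseteq> {..<length xs} \<and> S \<noteq> {}}.
      lam ^ (card S - 1) * delta (map (\<lambda>i. if i \<in> S then d0 (xs ! i) else xs ! i) [0..<length xs]) zs)"

definition ext1 :: "('a list \<Rightarrow> ('a list \<Rightarrow> 'k::comm_ring_1)) \<Rightarrow> ('a list \<Rightarrow> 'k) \<Rightarrow> ('a list \<Rightarrow> 'k)" where
  "ext1 op f = (\<lambda>zs. \<Sum>xs\<in>fsupp f. f xs * op xs zs)"

definition ext2 :: "('a list \<Rightarrow> 'a list \<Rightarrow> ('a list \<Rightarrow> 'k::comm_ring_1)) \<Rightarrow> ('a list \<Rightarrow> 'k) \<Rightarrow> ('a list \<Rightarrow> 'k) \<Rightarrow> ('a list \<Rightarrow> 'k)" where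
  "ext2 op f g = (\<lambda>zs. \<Sum>xs\<in>fsupp f. \<Sum>ys\<in>fsupp g. f xs * g ys * op xs ys zs)"

definition Fcar :: "('a list \<Rightarrow> 'k::zero) set" where
  "Fcar = {f. finite (fsupp f) \<and> f [] = 0}"

inductive_set Nrel :: "('k::comm_ring_1 \<Rightarrow> 'a::plus \<Rightarrow> 'a) \<Rightarrow> ('a list \<Rightarrow> 'k) set" for sA where
  gen_add: "delta (xs @ [a + b] @ ys) - delta (xs @ [a] @ ys) - delta (xs @ [b] @ ys) \<in> Nrel sA"
| gen_sc: "delta (xs @ [sA c a] @ ys) - fsc c (delta (xs @ [a] @ ys)) \<in> Nrel sA"
| zero: "0 \<in> Nrel sA"
| add: "f \<in> Nrel sA \<Longrightarrow> g \<in> Nrel sA \<Longrightarrow> f + g \<in> Nrel sA"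
| scal: "f \<in> Nrel sA \<Longrightarrow> fsc c f \<in> Nrel sA"

definition cls :: "('k::comm_ring_1 \<Rightarrow> 'a::plus \<Rightarrow> 'a) \<Rightarrow> ('a list \<Rightarrow> 'k) \<Rightarrow> ('a list \<Rightarrow> 'k) set" where
  "cls sA f = {g. g - f \<in> Nrel sA}"

definition TA :: "('k::comm_ring_1 \<Rightarrow> 'a::plus \<Rightarrow> 'a) \<Rightarrow> ('a list \<Rightarrow> 'k) set set" where
  "TA sA = cls sA ` Fcar"

definition rep :: "'b set \<Rightarrow> 'b" where
  "rep X = (SOME f. f \<in> X)"

definition addT where "addT sA X Y = cls sA (rep X + rep Y)"
definition scT where "scT sA c X = cls sA (fsc c (rep X))"
definition precT where "precT sA q X Y = cls sA (ext2 (prec_w sA q) (rep X) (rep Y))"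
definition succT where "succT sA q X Y = cls sA (ext2 (succ_w sA q) (rep X) (rep Y))"
definition bulT where "bulT sA q X Y = cls sA (ext2 (bul_w sA q) (rep X) (rep Y))"
definition dTA where "dTA sA lam d0 X = cls sA (ext1 (d_w lam d0) (rep X))"

definition jA where "jA sA a = cls sA (delta [a])"

end

theory Submission
  imports Defs
begin

text \<open>The quasi-shuffle product of words is commutative and associative already on the free module on
  words. Hence the tridendriform operations, which merely prefix a letter to a quasi-shuffle
  product, satisfy their axioms on representatives, up to splitting the product into its three
  parts, which uses \<open>q (a b) \<otimes> w = q ((a b) \<otimes> w)\<close> and is valid modulo multilinearity.
  Since \<open>d (a \<otimes> w) = d a \<otimes> w + a \<otimes> d w + \<lambda> d a \<otimes> d w\<close>, the derivation identity for a product of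
  words reduces to that for shorter words. As \<open>a \<otimes> w = a \<prec> w\<close>, a homomorphism extending \<open>\<psi>\<close> must
  be given by \<open>a \<otimes> w \<mapsto> \<psi> a \<prec> \<psi> w\<close>, and this defines one.\<close>

text \<open>Equality of classes is membership of a difference in \<open>Nrel sA\<close>. An identity
  is exact when its letters agree after computing in the algebra, and needs \<open>Nrel sA\<close>
  as soon as a letter has to be split as a sum or a scalar pulled out of it. Associativity of
  \<open>star\<close> is exact because \<open>q\<close> stays inside the merged letter; the
  derivation identity is not, because \<open>d0 (x * y)\<close> is a sum inside one tensor slot.

  The obstacle is the empty word: removing a first letter may leave it, yet it lies outside the
  tensor module. The product \<open>star\<close> accepts it, so the induction for the derivation
  runs on \<open>star\<close>: each of the three operations is a letter prefixed to a
  \<open>star\<close> product of smaller total length, and the splitting returns from them to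
  \<open>star\<close>. The same cycle shows that the extension respects products, but there the
  target has no unit to receive the empty word, so one-letter words are treated apart.\<close>

subsection \<open>Finitely supported functions on words\<close>

text \<open>As simplification rules, these leave \<open>\<lambda>x. f x + g x\<close> where \<open>f + g\<close> occurs eta-expanded,
  and the algebraic laws of functions no longer apply.\<close>

lemmas pointwise = plus_fun_apply zero_fun_apply minus_apply uminus_apply

declare pointwise [simp del]

definition finsupp :: "('a list \<Rightarrow> 'k::zero) \<Rightarrow> bool" where
  "finsupp f \<longleftrightarrow> finite (fsupp f)"

lemma finsupp_zero [simp]: "finsupp 0"
  by (simp add: finsupp_def fsupp_def pointwise)

lemma fsupp_delta [simp]: "fsupp (delta u :: 'a list \<Rightarrow> 'k::zero_neq_one) = {u}"
  by (auto simp: fsupp_def delta_def)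

lemma finsupp_delta [simp]: "finsupp (delta u :: 'a list \<Rightarrow> 'k::zero_neq_one)"
  by (simp add: finsupp_def)

lemma finsupp_add [simp]:
  fixes f g :: "'a list \<Rightarrow> 'k::comm_ring_1"
  assumes "finsupp f" "finsupp g"
  shows "finsupp (f + g)"
proof -
  have "fsupp (f + g) \<subseteq> fsupp f \<union> fsupp g"
    by (auto simp: fsupp_def pointwise)
  with assms show ?thesis
    unfolding finsupp_def by (meson finite_UnI finite_subset)
qed

lemma finsupp_fsc [simp]:
  fixes f :: "'a list \<Rightarrow> 'k::comm_ring_1"
  assumes "finsupp f"
  shows "finsupp (fsc c f)"
proof -
  have "fsupp (fsc c f) \<subseteq> fsupp f"
    by (auto simp: fsupp_def fsc_def)
  with assms show ?thesis
    unfolding finsupp_def by (meson finite_subset)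
qed

lemma finsupp_diff [simp]:
  fixes f g :: "'a list \<Rightarrow> 'k::comm_ring_1"
  assumes "finsupp f" "finsupp g"
  shows "finsupp (f - g)"
proof -
  have "f - g = f + fsc (- 1) g"
    by (auto simp: fsc_def pointwise fun_eq_iff)
  then show ?thesis using assms by (simp only: finsupp_add finsupp_fsc)
qed

lemma finsupp_sum:
  fixes f :: "'i \<Rightarrow> 'a list \<Rightarrow> 'k::comm_ring_1"
  assumes "\<And>i. i \<in> I \<Longrightarrow> finsupp (f i)"
  shows "finsupp (\<Sum>i\<in>I. f i)"
  using assms by (induction I rule: infinite_finite_induct) auto

lemma module_fsc: "module (fsc :: 'k::comm_ring_1 \<Rightarrow> ('a list \<Rightarrow> 'k) \<Rightarrow> _)"
  by unfold_locales (auto simp: fsc_def algebra_simps pointwise fun_eq_iff)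

interpretation fsc: module "fsc :: 'k::comm_ring_1 \<Rightarrow> ('a list \<Rightarrow> 'k) \<Rightarrow> _"
  by (rule module_fsc)

text \<open>Words are split off one at a time. The support bounds record that only words occurring
  in \<open>f\<close> are met, which lets the \<open>delta\<close> case assume
  \<open>f u \<noteq> 0\<close>; this is how statements about \<open>Fcar\<close> avoid the empty
  word.\<close>

lemma finsupp_induct [consumes 1, case_names zero delta add scale]:
  fixes f :: "'a list \<Rightarrow> 'k::comm_ring_1"
  assumes "finsupp f"
    and zero: "P 0"
    and delta: "\<And>u. f u \<noteq> 0 \<Longrightarrow> P (delta u)"
    and add: "\<And>g h. finsupp g \<Longrightarrow> finsupp h \<Longrightarrow> fsupp g \<subseteq> fsupp f \<Longrightarrow> fsupp h \<subseteq> fsupp f \<Longrightarrow>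
      P g \<Longrightarrow> P h \<Longrightarrow> P (g + h)"
    and scale: "\<And>c g. finsupp g \<Longrightarrow> fsupp g \<subseteq> fsupp f \<Longrightarrow> P g \<Longrightarrow> P (fsc c g)"
  shows "P f"
proof -
  have "P g" if "finite U" "fsupp g \<subseteq> U" "U \<subseteq> fsupp f" for U g
    using that
  proof (induction U arbitrary: g rule: finite_induct)
    case empty
    then have "g = 0" by (auto simp: fsupp_def pointwise fun_eq_iff)
    with zero show ?case by simp
  next
    case (insert u U)
    define g' where "g' = (\<lambda>w. if w = u then 0 else g w)"
    have g'_supp: "fsupp g' \<subseteq> U"
      using insert.prems by (auto simp: g'_def fsupp_def)
    with insert have Pg': "P g'" by auto
    have "finsupp g'"
      using g'_supp insert.hyps by (meson finite_subset finsupp_def)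
    have "u \<in> fsupp f" using insert.prems by auto
    then have u: "f u \<noteq> 0" by (auto simp: fsupp_def)
    have "fsupp (fsc (g u) (delta u)) \<subseteq> fsupp f"
      using u by (auto simp: fsupp_def fsc_def delta_def split: if_splits)
    moreover have "P (fsc (g u) (delta u))"
      using u by (intro scale delta finsupp_delta) (auto simp: fsupp_def delta_def split: if_splits)
    moreover have "fsupp g' \<subseteq> fsupp f"
      using g'_supp insert.prems by auto
    ultimately have "P (g' + fsc (g u) (delta u))"
      using Pg' \<open>finsupp g'\<close> by (intro add) auto
    also have "g' + fsc (g u) (delta u) = g"
      by (auto simp: g'_def fsc_def delta_def pointwise fun_eq_iff)
    finally show ?case .
  qed
  with assms(1) show ?thesis unfolding finsupp_def by blast
qed

lemma Fcar_iff: "f \<in> Fcar \<longleftrightarrow> finsupp f \<and> f [] = 0"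
  by (simp add: Fcar_def finsupp_def)

lemma Fcar_finsupp: "f \<in> Fcar \<Longrightarrow> finsupp f"
  by (simp add: Fcar_iff)

lemma Fcar_zero [simp]: "0 \<in> Fcar"
  by (simp add: Fcar_iff pointwise)

lemma Fcar_delta [simp]: "(delta u :: 'a list \<Rightarrow> 'k::zero_neq_one) \<in> Fcar \<longleftrightarrow> u \<noteq> []"
  by (simp add: Fcar_iff) (simp add: delta_def)

lemma Fcar_add [simp]:
  fixes f g :: "'a list \<Rightarrow> 'k::comm_ring_1"
  shows "f \<in> Fcar \<Longrightarrow> g \<in> Fcar \<Longrightarrow> f + g \<in> Fcar"
  by (simp add: Fcar_iff pointwise)

lemma Fcar_fsc [simp]:
  fixes f :: "'a list \<Rightarrow> 'k::comm_ring_1"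
  shows "f \<in> Fcar \<Longrightarrow> fsc c f \<in> Fcar"
  by (simp add: Fcar_iff pointwise) (simp add: fsc_def)

lemma Fcar_diff [simp]:
  fixes f g :: "'a list \<Rightarrow> 'k::comm_ring_1"
  shows "f \<in> Fcar \<Longrightarrow> g \<in> Fcar \<Longrightarrow> f - g \<in> Fcar"
  by (simp add: Fcar_iff pointwise)

lemma Fcar_induct [consumes 1, case_names zero delta add scale]:
  fixes f :: "'a list \<Rightarrow> 'k::comm_ring_1"
  assumes "f \<in> Fcar"
    and zero: "P 0"
    and delta: "\<And>u. u \<noteq> [] \<Longrightarrow> P (delta u)"
    and add: "\<And>g h. g \<in> Fcar \<Longrightarrow> h \<in> Fcar \<Longrightarrow> P g \<Longrightarrow> P h \<Longrightarrow> P (g + h)"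
    and scale: "\<And>c g. g \<in> Fcar \<Longrightarrow> P g \<Longrightarrow> P (fsc c g)"
  shows "P f"
proof -
  have f: "finsupp f" "[] \<notin> fsupp f"
    using assms(1) by (auto simp: Fcar_iff fsupp_def)
  have sub: "g \<in> Fcar" if "finsupp g" "fsupp g \<subseteq> fsupp f" for g :: "'a list \<Rightarrow> 'k"
    using that f(2) by (auto simp: Fcar_iff fsupp_def)
  show ?thesis
    using f(1)
  proof (induction rule: finsupp_induct)
    case zero
    show ?case by (rule assms(2))
  next
    case (delta u)
    then show ?case using f(2) by (intro assms(3)) (auto simp: fsupp_def)
  next
    case (add g h)
    then show ?case using sub by (intro assms(4)) auto
  next
    case (scale c g)
    then show ?case using sub by (intro assms(5)) auto
  qed
qed

lemma pcons_delta [simp]: "pcons x (delta u) = delta (x # u)"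
  by (auto simp: pcons_def delta_def fun_eq_iff pointwise split: list.splits)

lemma pcons_zero [simp]: "pcons x 0 = 0"
  by (auto simp: pcons_def fun_eq_iff pointwise split: list.splits)

lemma pcons_add:
  fixes f g :: "'a list \<Rightarrow> 'k::comm_ring_1"
  shows "pcons x (f + g) = pcons x f + pcons x g"
  by (auto simp: pcons_def fun_eq_iff pointwise split: list.splits)

lemma pcons_diff:
  fixes f g :: "'a list \<Rightarrow> 'k::comm_ring_1"
  shows "pcons x (f - g) = pcons x f - pcons x g"
  by (auto simp: pcons_def fun_eq_iff pointwise split: list.splits)

lemma pcons_fsc:
  fixes f :: "'a list \<Rightarrow> 'k::comm_ring_1"
  shows "pcons x (fsc c f) = fsc c (pcons x f)"
  by (auto simp: pcons_def fsc_def fun_eq_iff pointwise split: list.splits)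

lemma pcons_Nil [simp]: "pcons x f [] = 0"
  by (simp add: pcons_def)

lemma finsupp_pcons [simp]:
  fixes f :: "'a list \<Rightarrow> 'k::comm_ring_1"
  assumes "finsupp f"
  shows "finsupp (pcons x f)"
  using assms by (induction rule: finsupp_induct) (auto simp: pcons_add pcons_fsc)

lemma pcons_Fcar [simp]:
  fixes f :: "'a list \<Rightarrow> 'k::comm_ring_1"
  shows "finsupp f \<Longrightarrow> pcons x f \<in> Fcar"
  by (simp add: Fcar_iff)


subsection \<open>Linear maps and linear extension\<close>

text \<open>Restricted to finite support because \<open>lext\<close> and \<open>ext1\<close> sum
  over the support, and a sum over an infinite set is 0, so they are not additive on all
  functions.\<close>

definition lin :: "('k::comm_ring_1 \<Rightarrow> 'm::ab_group_add \<Rightarrow> 'm) \<Rightarrow> (('a list \<Rightarrow> 'k) \<Rightarrow> 'm) \<Rightarrow> bool" where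
  "lin sc F \<longleftrightarrow>
     (\<forall>f g. finsupp f \<longrightarrow> finsupp g \<longrightarrow> F (f + g) = F f + F g) \<and>
     (\<forall>c f. finsupp f \<longrightarrow> F (fsc c f) = sc c (F f))"

lemma linI:
  assumes "\<And>f g. finsupp f \<Longrightarrow> finsupp g \<Longrightarrow> F (f + g) = F f + F g"
    and "\<And>c f. finsupp f \<Longrightarrow> F (fsc c f) = sc c (F f)"
  shows "lin sc F"
  using assms by (simp add: lin_def)

lemma lin_plus: "lin sc F \<Longrightarrow> finsupp f \<Longrightarrow> finsupp g \<Longrightarrow> F (f + g) = F f + F g"
  by (simp add: lin_def)

lemma lin_scale: "lin sc F \<Longrightarrow> finsupp f \<Longrightarrow> F (fsc c f) = sc c (F f)"
  by (simp add: lin_def)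

lemma lin_zero:
  assumes "lin sc F"
  shows "F 0 = 0"
proof -
  have "F (0 + 0) = F 0 + F 0"
    using assms by (intro lin_plus) auto
  then show ?thesis by simp
qed

lemma lin_minus:
  assumes "lin sc F" "finsupp f" "finsupp g"
  shows "F (f - g) = F f - F g"
proof -
  have "F (f - g + g) = F (f - g) + F g"
    using assms by (intro lin_plus) auto
  then show ?thesis by simp
qed

lemma lin_add_fun:
  assumes "module sc" "lin sc F" "lin sc G"
  shows "lin sc (\<lambda>f. F f + G f)"
  using assms by (auto intro!: linI simp: lin_plus lin_scale module.scale_right_distrib)

lemma lin_scale_fun:
  assumes "module sc" "lin sc F"
  shows "lin sc (\<lambda>f. sc c (F f))"
  using assms
  by (auto intro!: linI simp: lin_plus lin_scale module.scale_right_distrib module.scale_scale mult.commute)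

lemma lin_id: "lin fsc (\<lambda>f. f)"
  by (simp add: lin_def)

lemma lin_pcons: "lin fsc (pcons x)"
  by (simp add: lin_def pcons_add pcons_fsc)

lemma lin_compose:
  assumes "lin sc G" "lin fsc F" "\<And>f. finsupp f \<Longrightarrow> finsupp (F f)"
  shows "lin sc (\<lambda>f. G (F f))"
  using assms by (auto intro!: linI simp: lin_plus lin_scale)

text \<open>Reduction to words: agreement is needed only on the words of \<open>f\<close>, so for
  \<open>f \<in> Fcar\<close> every test word has a first letter. With the zero submodule this gives
  equality, with \<open>Nrel sA\<close> congruence of combinations.\<close>

lemma lin_agree_mod:
  assumes sc: "module sc" and N: "module.subspace sc N"
    and F: "lin sc F" and G: "lin sc G" and f: "finsupp f"
    and eq: "\<And>u. f u \<noteq> 0 \<Longrightarrow> F (delta u) - G (delta u) \<in> N"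
  shows "F f - G f \<in> N"
  using f
proof (induction rule: finsupp_induct)
  case zero
  show ?case using lin_zero[OF F] lin_zero[OF G] module.subspace_0[OF sc N] by simp
next
  case (delta u)
  then show ?case by (rule eq)
next
  case (add g h)
  have "(F g - G g) + (F h - G h) \<in> N"
    using add by (intro module.subspace_add[OF sc N]) auto
  then show ?case using add by (simp add: lin_plus[OF F] lin_plus[OF G] algebra_simps)
next
  case (scale c g)
  have "sc c (F g - G g) \<in> N"
    using scale by (intro module.subspace_scale[OF sc N]) auto
  then show ?case
    using scale by (simp add: lin_scale[OF F] lin_scale[OF G] module.scale_right_diff_distrib[OF sc])
qed

lemma lin_agree:
  assumes "module sc" "lin sc F" "lin sc G" "finsupp f"
    and "\<And>u. f u \<noteq> 0 \<Longrightarrow> F (delta u) = G (delta u)"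
  shows "F f = G f"
  using lin_agree_mod[OF assms(1) module.subspace_single_0[OF assms(1)] assms(2-4)] assms(5) by auto

definition lext :: "('k::comm_ring_1 \<Rightarrow> 'm::ab_group_add \<Rightarrow> 'm) \<Rightarrow> ('a list \<Rightarrow> 'm) \<Rightarrow> ('a list \<Rightarrow> 'k) \<Rightarrow> 'm" where
  "lext sc h f = (\<Sum>u\<in>fsupp f. sc (f u) (h u))"

lemma lext_superset:
  assumes "module sc" "finite U" "fsupp f \<subseteq> U"
  shows "lext sc h f = (\<Sum>u\<in>U. sc (f u) (h u))"
  unfolding lext_def using assms
  by (intro sum.mono_neutral_left) (auto simp: fsupp_def module.scale_zero_left)

lemma lin_lext:
  assumes "module sc"
  shows "lin sc (lext sc h)"
proof (rule linI)
  fix f g :: "'c list \<Rightarrow> 'a" assume fg: "finsupp f" "finsupp g"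
  let ?U = "fsupp f \<union> fsupp g"
  have U: "finite ?U" "fsupp (f + g) \<subseteq> ?U" "fsupp f \<subseteq> ?U" "fsupp g \<subseteq> ?U"
    using fg by (auto simp: finsupp_def fsupp_def pointwise)
  show "lext sc h (f + g) = lext sc h f + lext sc h g"
    unfolding lext_superset[OF assms U(1,2)] lext_superset[OF assms U(1,3)] lext_superset[OF assms U(1,4)]
    by (simp add: pointwise module.scale_left_distrib[OF assms] sum.distrib)
next
  fix c :: 'a and f :: "'c list \<Rightarrow> 'a" assume f: "finsupp f"
  then have U: "finite (fsupp f)" "fsupp (fsc c f) \<subseteq> fsupp f"
    by (auto simp: finsupp_def fsupp_def fsc_def)
  show "lext sc h (fsc c f) = sc c (lext sc h f)"
    unfolding lext_superset[OF assms U]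
    unfolding lext_def by (simp add: fsc_def module.scale_sum_right[OF assms] module.scale_scale[OF assms])
qed

lemma sum_apply_fun: "(\<Sum>i\<in>I. f i) x = (\<Sum>i\<in>I. f i x)"
  by (induction I rule: infinite_finite_induct) (auto simp: pointwise)

lemma lext_delta: "module sc \<Longrightarrow> lext sc h (delta u) = h u"
  by (simp add: lext_def module.scale_one) (simp add: delta_def module.scale_one)

lemma ext1_eq_lext: "ext1 op f = lext fsc op f"
  unfolding ext1_def lext_def
  by (rule ext) (simp add: sum_apply_fun fsc_def)

lemma lin_ext1: "lin fsc (ext1 op)"
  using lin_lext[OF module_fsc, of op] by (simp add: lin_def ext1_eq_lext)

lemma ext1_delta [simp]: "ext1 op (delta u) = op u"
  by (simp add: ext1_eq_lext lext_delta[OF module_fsc])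

lemma finsupp_ext1:
  assumes "\<And>u. finsupp (op u)"
  shows "finsupp (ext1 op f)"
  unfolding ext1_eq_lext lext_def using assms by (intro finsupp_sum) auto

lemma ext2_eq_ext1: "ext2 op f g = ext1 (\<lambda>u. ext1 (op u) g) f"
  by (simp add: ext2_def ext1_def fun_eq_iff sum_distrib_left mult.assoc)

lemma ext2_eq_ext1': "ext2 op f g = ext1 (\<lambda>v. ext1 (\<lambda>u. op u v) f) g"
  unfolding ext2_def ext1_def fun_eq_iff sum_distrib_left
  by (subst sum.swap) (simp add: mult.assoc mult.left_commute)

lemma lin_ext2_left: "lin fsc (\<lambda>f. ext2 op f g)"
  unfolding ext2_eq_ext1 by (rule lin_ext1)

lemma lin_ext2_right: "lin fsc (ext2 op f)"
  using lin_ext1 by (simp add: ext2_eq_ext1' lin_def)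

lemma ext2_delta [simp]: "ext2 op (delta u) (delta v) = op u v"
  by (simp add: ext2_eq_ext1)

lemma finsupp_ext2:
  assumes "\<And>u v. finsupp (op u v)"
  shows "finsupp (ext2 op f g)"
  unfolding ext2_eq_ext1 using assms by (intro finsupp_ext1) auto

lemma ext2_flip: "ext2 op f g = ext2 (\<lambda>u v. op v u) g f"
  unfolding ext2_eq_ext1 [of op] ext2_eq_ext1' [of "\<lambda>u v. op v u"] ..

lemma lin_pcons_fun: "lin fsc F \<Longrightarrow> lin fsc (\<lambda>f. pcons x (F f))"
  by (simp add: lin_def pcons_add pcons_fsc)

lemma lin_ext1_fun:
  assumes "lin fsc F" "\<And>f. finsupp f \<Longrightarrow> finsupp (F f)"
  shows "lin fsc (\<lambda>f. ext1 op (F f))"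
  using lin_ext1 assms by (rule lin_compose)

lemma lin_ext2_left_fun:
  assumes "lin fsc F" "\<And>f. finsupp f \<Longrightarrow> finsupp (F f)"
  shows "lin fsc (\<lambda>f. ext2 op (F f) g)"
  using lin_ext2_left assms by (rule lin_compose)

lemma lin_ext2_right_fun:
  assumes "lin fsc F" "\<And>f. finsupp f \<Longrightarrow> finsupp (F f)"
  shows "lin fsc (\<lambda>f. ext2 op g (F f))"
  using lin_ext2_right assms by (rule lin_compose)

lemmas lin_intros = lin_id lin_add_fun[OF module_fsc] lin_scale_fun[OF module_fsc] lin_pcons_fun
  lin_ext1_fun lin_ext2_left_fun lin_ext2_right_fun

lemmas ext2_add_left = lin_plus[OF lin_ext2_left]
lemmas ext2_add_right = lin_plus[OF lin_ext2_right]
lemmas ext2_diff_left = lin_minus[OF lin_ext2_left]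
lemmas ext2_diff_right = lin_minus[OF lin_ext2_right]
lemmas ext2_fsc_left = lin_scale[OF lin_ext2_left]
lemmas ext2_fsc_right = lin_scale[OF lin_ext2_right]
lemmas ext1_add = lin_plus[OF lin_ext1]
lemmas ext1_diff = lin_minus[OF lin_ext1]
lemmas ext1_fsc = lin_scale[OF lin_ext1]

lemma bilin_agree_mod:
  assumes sc: "module sc" and N: "module.subspace sc N"
    and F: "\<And>g. finsupp g \<Longrightarrow> lin sc (\<lambda>f. F f g)" "\<And>f. finsupp f \<Longrightarrow> lin sc (F f)"
    and G: "\<And>g. finsupp g \<Longrightarrow> lin sc (\<lambda>f. G f g)" "\<And>f. finsupp f \<Longrightarrow> lin sc (G f)"
    and fin: "finsupp f" "finsupp g"
    and eq: "\<And>u v. f u \<noteq> 0 \<Longrightarrow> g v \<noteq> 0 \<Longrightarrow> F (delta u) (delta v) - G (delta u) (delta v) \<in> N"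
  shows "F f g - G f g \<in> N"
proof (rule lin_agree_mod[OF sc N, where F = "\<lambda>f. F f g" and G = "\<lambda>f. G f g"])
  fix u assume u: "f u \<noteq> 0"
  show "F (delta u) g - G (delta u) g \<in> N"
    by (rule lin_agree_mod[OF sc N F(2) G(2) fin(2) eq[OF u]]) simp_all
qed (rule F(1) G(1) fin)+

lemma bilin_agree:
  assumes "module sc"
    and "\<And>g. finsupp g \<Longrightarrow> lin sc (\<lambda>f. F f g)" "\<And>f. finsupp f \<Longrightarrow> lin sc (F f)"
    and "\<And>g. finsupp g \<Longrightarrow> lin sc (\<lambda>f. G f g)" "\<And>f. finsupp f \<Longrightarrow> lin sc (G f)"
    and "finsupp f" "finsupp g"
    and "\<And>u v. f u \<noteq> 0 \<Longrightarrow> g v \<noteq> 0 \<Longrightarrow> F (delta u) (delta v) = G (delta u) (delta v)"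
  shows "F f g = G f g"
proof -
  have "F f g - G f g \<in> {0}"
    by (rule bilin_agree_mod[OF assms(1) module.subspace_single_0[OF assms(1)] assms(2-7)])
      (simp_all add: assms(8))
  then show ?thesis by simp
qed

lemma trilin_agree:
  assumes sc: "module sc"
    and F: "\<And>g h. finsupp g \<Longrightarrow> finsupp h \<Longrightarrow> lin sc (\<lambda>f. F f g h)"
      "\<And>f h. finsupp f \<Longrightarrow> finsupp h \<Longrightarrow> lin sc (\<lambda>g. F f g h)"
      "\<And>f g. finsupp f \<Longrightarrow> finsupp g \<Longrightarrow> lin sc (F f g)"
    and G: "\<And>g h. finsupp g \<Longrightarrow> finsupp h \<Longrightarrow> lin sc (\<lambda>f. G f g h)"
      "\<And>f h. finsupp f \<Longrightarrow> finsupp h \<Longrightarrow> lin sc (\<lambda>g. G f g h)"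
      "\<And>f g. finsupp f \<Longrightarrow> finsupp g \<Longrightarrow> lin sc (G f g)"
    and fin: "finsupp f" "finsupp g" "finsupp h"
    and eq: "\<And>u v w. f u \<noteq> 0 \<Longrightarrow> g v \<noteq> 0 \<Longrightarrow> h w \<noteq> 0 \<Longrightarrow>
      F (delta u) (delta v) (delta w) = G (delta u) (delta v) (delta w)"
  shows "F f g h = G f g h"
proof (rule lin_agree[OF sc, where F = "\<lambda>f. F f g h" and G = "\<lambda>f. G f g h"])
  fix u assume u: "f u \<noteq> 0"
  show "F (delta u) g h = G (delta u) g h"
    by (rule bilin_agree[OF sc F(2,3) G(2,3) fin(2,3) eq[OF u]]) simp_all
qed (rule F(1) G(1) fin)+


subsection \<open>The multilinearity relations\<close>

lemma subspace_Nrel: "fsc.subspace (Nrel sA)"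
  by (rule fsc.subspaceI) (auto intro: Nrel.intros)

lemma Nrel_diff: "f \<in> Nrel sA \<Longrightarrow> g \<in> Nrel sA \<Longrightarrow> f - g \<in> Nrel sA"
  by (rule fsc.subspace_diff[OF subspace_Nrel])

lemma Nrel_uminus: "f \<in> Nrel sA \<Longrightarrow> - f \<in> Nrel sA"
  by (rule fsc.subspace_neg[OF subspace_Nrel])

lemma Nrel_Fcar: "f \<in> Nrel sA \<Longrightarrow> f \<in> Fcar"
  by (induction rule: Nrel.induct) simp_all

text \<open>The argument of \<open>h\<close> is thought of as a letter in one tensor slot. For
  \<open>N = Nrel sA\<close> this is linearity into the quotient, and the generators of
  \<open>Nrel sA\<close> say exactly that inserting a letter into a word has it; for
  \<open>N = {0}\<close> it is linearity proper.\<close>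

definition lin_mod ::
  "('k::comm_ring_1 \<Rightarrow> 'a::plus \<Rightarrow> 'a) \<Rightarrow> ('k \<Rightarrow> 'm::ab_group_add \<Rightarrow> 'm) \<Rightarrow> 'm set \<Rightarrow> ('a \<Rightarrow> 'm) \<Rightarrow> bool" where
  "lin_mod sA sc N h \<longleftrightarrow>
     (\<forall>a b. h (a + b) - h a - h b \<in> N) \<and> (\<forall>c a. h (sA c a) - sc c (h a) \<in> N)"

lemma lin_mod_zero:
  assumes "module sc" "module.subspace sc N"
  shows "lin_mod sA sc N (\<lambda>a. 0)"
  using assms by (simp add: lin_mod_def module.scale_zero_right module.subspace_0)

lemma lin_mod_add:
  assumes "module sc" "module.subspace sc N" "lin_mod sA sc N g" "lin_mod sA sc N h"
  shows "lin_mod sA sc N (\<lambda>a. g a + h a)"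
  unfolding lin_mod_def
proof (intro conjI allI)
  fix a b
  have "(g (a + b) - g a - g b) + (h (a + b) - h a - h b) \<in> N"
    using assms by (intro module.subspace_add) (auto simp: lin_mod_def)
  then show "g (a + b) + h (a + b) - (g a + h a) - (g b + h b) \<in> N"
    by (simp add: algebra_simps)
next
  fix c a
  have "(g (sA c a) - sc c (g a)) + (h (sA c a) - sc c (h a)) \<in> N"
    using assms by (intro module.subspace_add) (auto simp: lin_mod_def)
  then show "g (sA c a) + h (sA c a) - sc c (g a + h a) \<in> N"
    by (simp add: module.scale_right_distrib[OF assms(1)] algebra_simps)
qed

lemma lin_mod_scale:
  assumes sc: "module sc" and N: "module.subspace sc N" and h: "lin_mod sA sc N h"
  shows "lin_mod sA sc N (\<lambda>a. sc k (h a))"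
  unfolding lin_mod_def
proof (intro conjI allI)
  fix a b
  have "sc k (h (a + b) - h a - h b) \<in> N"
    using h unfolding lin_mod_def by (intro module.subspace_scale[OF sc N]) blast
  then show "sc k (h (a + b)) - sc k (h a) - sc k (h b) \<in> N"
    unfolding module.scale_right_diff_distrib[OF sc] .
next
  fix c a
  have "sc k (h (sA c a) - sc c (h a)) \<in> N"
    using h unfolding lin_mod_def by (intro module.subspace_scale[OF sc N]) blast
  then show "sc k (h (sA c a)) - sc c (sc k (h a)) \<in> N"
    unfolding module.scale_right_diff_distrib[OF sc] module.scale_left_commute[OF sc, of c] .
qed

lemma lin_mod_comp:
  assumes "lin_mod sA sc N h" "\<And>a b. \<phi> (a + b) = \<phi> a + \<phi> b" "\<And>c a. \<phi> (sA c a) = sA c (\<phi> a)"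
  shows "lin_mod sA sc N (\<lambda>a. h (\<phi> a))"
  using assms by (simp add: lin_mod_def)

lemma pcons_Nrel:
  assumes "f \<in> Nrel sA"
  shows "pcons x f \<in> Nrel sA"
  using assms
proof (induction rule: Nrel.induct)
  case (gen_add xs a b ys)
  show ?case using Nrel.gen_add[of "x # xs" a b ys sA] by (simp add: pcons_diff)
next
  case (gen_sc xs c a ys)
  show ?case using Nrel.gen_sc[of "x # xs" sA c a ys] by (simp add: pcons_diff pcons_fsc)
qed (auto simp: pcons_add pcons_fsc intro: Nrel.intros)

lemma lin_mod_pcons_fun:
  assumes "lin_mod sA fsc (Nrel sA) h"
  shows "lin_mod sA fsc (Nrel sA) (\<lambda>a. pcons x (h a))"
  using assms pcons_Nrel
  unfolding lin_mod_def by (metis pcons_diff pcons_fsc)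

lemma lin_mod_delta: "lin_mod sA fsc (Nrel sA) (\<lambda>a. delta (xs @ [a] @ ys))"
  unfolding lin_mod_def by (auto intro: Nrel.gen_add Nrel.gen_sc simp del: append.simps)

lemma lin_mod_pcons:
  assumes "finsupp f"
  shows "lin_mod sA fsc (Nrel sA) (\<lambda>a. pcons a f)"
  using assms
proof (induction rule: finsupp_induct)
  case zero
  show ?case by (simp add: lin_mod_zero module_fsc subspace_Nrel)
next
  case (delta u)
  show ?case using lin_mod_delta[of sA "[]" u] by simp
next
  case (add g h)
  then show ?case
    unfolding pcons_add by (intro lin_mod_add module_fsc subspace_Nrel)
next
  case (scale c g)
  then show ?case
    unfolding pcons_fsc by (intro lin_mod_scale[OF module_fsc subspace_Nrel])
qed

text \<open>Generators suffice, and on them the claim is linearity in every slot of every word.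
  Taken with \<open>Nrel sA\<close> it makes the operations descend to classes, with
  \<open>{0}\<close> it factors the extension through them.\<close>

lemma lin_Nrel:
  assumes sc: "module sc" and N: "module.subspace sc N" and F: "lin sc F"
    and words: "\<And>xs ys. lin_mod sA sc N (\<lambda>a. F (delta (xs @ [a] @ ys)))"
    and f: "f \<in> Nrel sA"
  shows "F f \<in> N"
  using f
proof (induction rule: Nrel.induct)
  case (gen_add xs a b ys)
  show ?case using words[of xs ys] by (simp add: lin_minus[OF F] lin_mod_def)
next
  case (gen_sc xs c a ys)
  show ?case using words[of xs ys] by (simp add: lin_minus[OF F] lin_scale[OF F] lin_mod_def)
next
  case zero
  show ?case by (simp add: lin_zero[OF F] module.subspace_0[OF sc N])
next
  case (add f g)
  then show ?case
    by (simp add: lin_plus[OF F] Nrel_Fcar Fcar_finsupp module.subspace_add[OF sc N])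
next
  case (scal f c)
  then show ?case
    by (simp add: lin_scale[OF F] Nrel_Fcar Fcar_finsupp module.subspace_scale[OF sc N])
qed

lemmas lin_mod_intros = lin_mod_add[OF module_fsc subspace_Nrel]
  lin_mod_scale[OF module_fsc subspace_Nrel] lin_mod_pcons_fun


subsection \<open>The quasi-shuffle product on words\<close>

lemma qsh_Nil2 [simp]: "qsh sA q u [] = delta u"
  by (cases u) auto

lemma qsh_commute: "qsh sA q u v = qsh sA q v u"
  for u v :: "'a::ab_semigroup_mult list"
  by (induction sA q u v rule: qsh.induct) (auto simp: ac_simps)

locale comm_algebra =
  fixes sA :: "'k::comm_ring_1 \<Rightarrow> 'a::comm_ring \<Rightarrow> 'a" and q :: 'k
  assumes module_A: "module sA" and scale_mult: "sA c (a * b) = sA c a * b"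
begin

abbreviation "N \<equiv> Nrel sA"
abbreviation "star \<equiv> ext2 (qsh sA q)"
abbreviation "prec \<equiv> ext2 (prec_w sA q)"
abbreviation "succ \<equiv> ext2 (succ_w sA q)"
abbreviation "bul \<equiv> ext2 (bul_w sA q)"

lemma scale_mult_right: "a * sA c b = sA c (a * b)"
  by (metis mult.commute scale_mult)

lemma finsupp_qsh [simp]: "finsupp (qsh sA q u v)"
  by (induction sA q u v rule: qsh.induct) auto

lemma finsupp_prec_w [simp]: "finsupp (prec_w sA q u v)"
  by (cases u) auto

lemma finsupp_succ_w [simp]: "finsupp (succ_w sA q u v)"
  by (cases v) auto

lemma finsupp_bul_w [simp]: "finsupp (bul_w sA q u v)"
  by (cases u; cases v) auto

lemma finsupp_ops [simp]:
  "finsupp (star f g)" "finsupp (prec f g)" "finsupp (succ f g)" "finsupp (bul f g)"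
  by (simp_all add: finsupp_ext2)

section \<open>Commutativity and associativity of the quasi-shuffle product\<close>

lemma star_commute: "star f g = star g f"
proof -
  have "(\<lambda>u v. qsh sA q v u) = qsh sA q"
    by (intro ext qsh_commute)
  then show ?thesis by (subst ext2_flip) simp
qed

lemma star_Nil_left [simp]: "finsupp g \<Longrightarrow> star (delta []) g = g"
  by (rule lin_agree[OF module_fsc lin_ext2_right lin_id]) auto

lemma star_Nil_right [simp]: "finsupp f \<Longrightarrow> star f (delta []) = f"
  by (simp add: star_commute[of f])

text \<open>The recursion on words, carried to combinations by bilinearity: a product of two words
  is already a combination, so iterated products need this form.\<close>

lemma star_pcons:
  assumes "finsupp f" "finsupp g"
  shows "star (pcons x f) (pcons y g) =
    pcons x (star f (pcons y g)) + pcons y (star (pcons x f) g) + pcons (sA q (x * y)) (star f g)"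
  by (rule bilin_agree[OF module_fsc, where F = "\<lambda>f g. star (pcons x f) (pcons y g)" and
        G = "\<lambda>f g. pcons x (star f (pcons y g)) + pcons y (star (pcons x f) g) +
          pcons (sA q (x * y)) (star f g)"])
    (use assms in \<open>auto intro!: lin_intros\<close>)

text \<open>The seven terms correspond to the nonempty subsets of \<open>x\<close>,
  \<open>y\<close>, \<open>z\<close> that merge into the first letter of the result; each merging of
  two letters brings one factor \<open>q\<close>.\<close>

lemma star_assoc_expand:
  assumes "finsupp f" "finsupp g" "finsupp h"
  shows "star (star (pcons x f) (pcons y g)) (pcons z h) =
      pcons x (star (star f (pcons y g)) (pcons z h))
    + pcons y (star (star (pcons x f) g) (pcons z h))
    + pcons z (star (star (pcons x f) (pcons y g)) h)
    + pcons (sA q (x * y)) (star (star f g) (pcons z h))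
    + pcons (sA q (x * z)) (star (star f (pcons y g)) h)
    + pcons (sA q (y * z)) (star (star (pcons x f) g) h)
    + pcons (sA q (sA q (x * y) * z)) (star (star f g) h)"
  using assms by (simp add: star_pcons ext2_add_left pcons_add ac_simps)

text \<open>Compares the terms where all three letters merge: after reversing the factors, the two
  powers of \<open>q\<close> sit at differently nested places.\<close>

lemma scale_mult_rotate: "sA q (z * sA q (x * y)) = sA q (x * sA q (y * z))"
  by (simp add: scale_mult_right ac_simps)

text \<open>Given commutativity, this is associativity; both sides expand by the same lemma.\<close>

lemma star_reverse_delta:
  "star (star (delta u) (delta v)) (delta w) = star (star (delta w) (delta v)) (delta u)"
proof (induction "length u + length v + length w" arbitrary: u v w rule: less_induct)
  case less
  show ?case
  proof (cases "u = [] \<or> v = [] \<or> w = []")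
    case True
    then show ?thesis by (auto simp: star_commute simp del: ext2_delta)
  next
    case False
    then obtain x u' y v' z w' where uvw: "u = x # u'" "v = y # v'" "w = z # w'"
      by (meson neq_Nil_conv)
    have IH: "star (star (delta u') (delta v)) (delta w) = star (star (delta w) (delta v)) (delta u')"
      "star (star (delta u) (delta v')) (delta w) = star (star (delta w) (delta v')) (delta u)"
      "star (star (delta u) (delta v)) (delta w') = star (star (delta w') (delta v)) (delta u)"
      "star (star (delta u') (delta v')) (delta w) = star (star (delta w) (delta v')) (delta u')"
      "star (star (delta u') (delta v)) (delta w') = star (star (delta w') (delta v)) (delta u')"
      "star (star (delta u) (delta v')) (delta w') = star (star (delta w') (delta v')) (delta u)"
      "star (star (delta u') (delta v')) (delta w') = star (star (delta w') (delta v')) (delta u')"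
      by (rule less; simp add: uvw)+
    show ?thesis
      using star_assoc_expand[of "delta u'" "delta v'" "delta w'" x y z]
        star_assoc_expand[of "delta w'" "delta v'" "delta u'" z y x]
      by (simp del: ext2_delta add: uvw[symmetric] IH scale_mult_rotate[of z x y] mult.commute ac_simps)
  qed
qed

lemma star_reverse:
  assumes "finsupp f" "finsupp g" "finsupp h"
  shows "star (star f g) h = star (star h g) f"
  by (rule trilin_agree[OF module_fsc, where F = "\<lambda>f g h. star (star f g) h" and
        G = "\<lambda>f g h. star (star h g) f"])
    (use assms star_reverse_delta in \<open>auto intro!: lin_intros simp del: ext2_delta\<close>)

lemma star_assoc:
  assumes "finsupp f" "finsupp g" "finsupp h"
  shows "star (star f g) h = star f (star g h)"
  using star_reverse[OF assms] by (simp only: star_commute)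

section \<open>Tridendriform identities for combinations of words\<close>

lemma prec_pcons:
  assumes "finsupp f" "finsupp g"
  shows "prec (pcons x f) g = pcons x (star f g)"
  by (rule bilin_agree[OF module_fsc, where F = "\<lambda>f g. prec (pcons x f) g" and
        G = "\<lambda>f g. pcons x (star f g)"])
    (use assms in \<open>auto intro!: lin_intros\<close>)

lemma bul_pcons:
  assumes "finsupp f" "finsupp g"
  shows "bul (pcons x f) (pcons y g) = pcons (x * y) (star f g)"
  by (rule bilin_agree[OF module_fsc, where F = "\<lambda>f g. bul (pcons x f) (pcons y g)" and
        G = "\<lambda>f g. pcons (x * y) (star f g)"])
    (use assms in \<open>auto intro!: lin_intros\<close>)

lemma succ_eq_prec: "succ f g = prec g f"
proof -
  have "succ_w sA q u v = prec_w sA q v u" for u v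
    by (cases v) (auto simp: qsh_commute)
  then show ?thesis by (subst ext2_flip) simp
qed

lemma bul_commute: "bul f g = bul g f"
proof -
  have "bul_w sA q u v = bul_w sA q v u" for u v
    by (cases u; cases v) (auto simp: qsh_commute mult.commute)
  then show ?thesis by (subst ext2_flip) simp
qed

lemma ops_Fcar [simp]: "prec f g \<in> Fcar" "succ f g \<in> Fcar" "bul f g \<in> Fcar"
proof -
  have "prec_w sA q u v [] = 0" for u v
    by (cases u) (auto simp: pointwise)
  moreover have "bul_w sA q u v [] = 0" for u v
    by (cases u; cases v) (auto simp: pointwise)
  ultimately have "prec f g [] = 0" "bul f g [] = 0" for f g
    by (simp_all add: ext2_def)
  then show "prec f g \<in> Fcar" "bul f g \<in> Fcar" "succ f g \<in> Fcar"
    by (simp_all add: Fcar_iff succ_eq_prec)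
qed

lemma star_Fcar:
  assumes "f \<in> Fcar" "finsupp g"
  shows "star f g \<in> Fcar"
proof -
  have "qsh sA q u v [] = 0" if "u \<noteq> []" for u v
    using that by (cases u; cases v) (auto simp: delta_def pointwise)
  moreover have "u \<noteq> []" if "u \<in> fsupp f" for u
    using that assms(1) by (auto simp: fsupp_def Fcar_iff)
  ultimately have "star f g [] = 0"
    unfolding ext2_def by (intro sum.neutral ballI) simp
  then show ?thesis by (simp add: Fcar_iff)
qed

lemma Fcar_Cons: "f \<in> Fcar \<Longrightarrow> f u \<noteq> 0 \<Longrightarrow> \<exists>x u'. u = x # u'"
  by (cases u) (auto simp: Fcar_iff)

text \<open>For a word \<open>x # u'\<close> of \<open>f\<close>, both sides prefix \<open>x\<close>
  to the quasi-shuffle product of \<open>u'\<close>, \<open>g\<close> and \<open>h\<close>, so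
  associativity of \<open>star\<close> decides. With \<open>star\<close> on the right-hand side the
  identity is exact.\<close>

lemma prec_prec:
  assumes "f \<in> Fcar" "finsupp g" "finsupp h"
  shows "prec (prec f g) h = prec f (star g h)"
proof (rule trilin_agree[OF module_fsc, where F = "\<lambda>f g h. prec (prec f g) h" and
      G = "\<lambda>f g h. prec f (star g h)"])
  fix u v w assume "f u \<noteq> 0"
  with assms(1) obtain x u' where "u = x # u'"
    by (blast dest: Fcar_Cons)
  then have u: "delta u = pcons x (delta u')" by simp
  show "prec (prec (delta u) (delta v)) (delta w) = prec (delta u) (star (delta v) (delta w))"
    unfolding u by (simp only: prec_pcons star_assoc finsupp_ops finsupp_delta)
qed (use assms in \<open>auto intro!: lin_intros simp: Fcar_finsupp\<close>)

lemma prec_bul: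
  assumes "f \<in> Fcar" "g \<in> Fcar" "finsupp h"
  shows "prec (bul f g) h = bul f (prec g h)"
proof (rule trilin_agree[OF module_fsc, where F = "\<lambda>f g h. prec (bul f g) h" and
      G = "\<lambda>f g h. bul f (prec g h)"])
  fix u v w assume "f u \<noteq> 0" "g v \<noteq> 0"
  then obtain x u' y v' where "u = x # u'" "v = y # v'"
    using assms(1,2)[THEN Fcar_Cons] by meson
  then have uv: "delta u = pcons x (delta u')" "delta v = pcons y (delta v')" by auto
  show "prec (bul (delta u) (delta v)) (delta w) = bul (delta u) (prec (delta v) (delta w))"
    unfolding uv by (simp only: prec_pcons bul_pcons star_assoc finsupp_ops finsupp_delta)
qed (use assms in \<open>auto intro!: lin_intros simp: Fcar_finsupp\<close>)

lemma bul_assoc: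
  assumes "f \<in> Fcar" "g \<in> Fcar" "h \<in> Fcar"
  shows "bul (bul f g) h = bul f (bul g h)"
proof (rule trilin_agree[OF module_fsc, where F = "\<lambda>f g h. bul (bul f g) h" and
      G = "\<lambda>f g h. bul f (bul g h)"])
  fix u v w assume "f u \<noteq> 0" "g v \<noteq> 0" "h w \<noteq> 0"
  then obtain x u' y v' z w' where "u = x # u'" "v = y # v'" "w = z # w'"
    using assms[THEN Fcar_Cons] by meson
  then have uvw: "delta u = pcons x (delta u')" "delta v = pcons y (delta v')"
    "delta w = pcons z (delta w')" by auto
  show "bul (bul (delta u) (delta v)) (delta w) = bul (delta u) (bul (delta v) (delta w))"
    unfolding uvw by (simp only: bul_pcons star_assoc finsupp_ops finsupp_delta mult.assoc)
qed (use assms in \<open>auto intro!: lin_intros simp: Fcar_finsupp\<close>)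

lemma star_split:
  assumes "f \<in> Fcar" "g \<in> Fcar"
  shows "star f g - (prec f g + succ f g + fsc q (bul f g)) \<in> N"
proof (rule bilin_agree_mod[OF module_fsc subspace_Nrel, where F = star and
      G = "\<lambda>f g. prec f g + succ f g + fsc q (bul f g)"])
  fix u v assume "f u \<noteq> 0" "g v \<noteq> 0"
  then obtain x u' y v' where uv: "u = x # u'" "v = y # v'"
    using assms(1,2)[THEN Fcar_Cons] by meson
  have "pcons (sA q (x * y)) (qsh sA q u' v') - fsc q (pcons (x * y) (qsh sA q u' v')) \<in> N"
    using lin_mod_pcons[of "qsh sA q u' v'" sA] by (simp add: lin_mod_def)
  then show "star (delta u) (delta v) -
      (prec (delta u) (delta v) + succ (delta u) (delta v) + fsc q (bul (delta u) (delta v))) \<in> N"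
    by (simp add: uv)
qed (use assms in \<open>auto intro!: lin_intros simp: Fcar_finsupp\<close>)

section \<open>Compatibility of the products with the relations\<close>

text \<open>The recursion strips a letter in front of the slot, shortens \<open>v\<close>, or both,
  while \<open>ys\<close> stays fixed; this dictates the measure. Once the slot is in front, its
  letter is prefixed alone or as the merged letter \<open>sA q (a * y)\<close>, both linear in
  \<open>a\<close>, and the term prefixing \<open>y\<close> falls under the induction
  hypothesis.\<close>

lemma lin_mod_qsh: "lin_mod sA fsc N (\<lambda>a. qsh sA q (xs @ [a] @ ys) v)"
proof (induction "length xs + length v" arbitrary: xs v rule: less_induct)
  case less
  show ?case
  proof (cases v)
    case Nil
    then show ?thesis using lin_mod_delta[of sA xs ys] by simp
  next
    case (Cons y v')
    have IH: "lin_mod sA fsc N (\<lambda>a. qsh sA q (xs @ [a] @ ys) v')"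
      by (rule less) (simp add: Cons)
    show ?thesis
    proof (cases xs)
      case Nil
      have "lin_mod sA fsc N (\<lambda>a. pcons (sA q (a * y)) (qsh sA q ys v'))"
        by (rule lin_mod_comp[where h = "\<lambda>a. pcons a (qsh sA q ys v')"])
          (simp_all add: lin_mod_pcons distrib_right module.scale_right_distrib[OF module_A]
            scale_mult[symmetric] module.scale_scale[OF module_A] mult.commute[of q])
      then show ?thesis
        using IH unfolding Cons Nil by (auto intro!: lin_mod_intros lin_mod_pcons)
    next
      case (Cons x xs')
      have "lin_mod sA fsc N (\<lambda>a. qsh sA q (xs' @ [a] @ ys) v)"
        "lin_mod sA fsc N (\<lambda>a. qsh sA q (xs' @ [a] @ ys) v')"
        by (rule less; simp add: Cons \<open>v = y # v'\<close>)+
      then show ?thesis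
        using IH unfolding Cons \<open>v = y # v'\<close> by (auto intro!: lin_mod_intros)
    qed
  qed
qed

lemma lin_mod_prec_left: "lin_mod sA fsc N (\<lambda>a. prec_w sA q (xs @ [a] @ ys) v)"
proof (cases xs)
  case (Cons x xs')
  then show ?thesis using lin_mod_qsh[of xs' ys v] by (auto intro!: lin_mod_intros)
qed (simp add: lin_mod_pcons)

lemma lin_mod_prec_right: "lin_mod sA fsc N (\<lambda>a. prec_w sA q u (xs @ [a] @ ys))"
proof (cases u)
  case (Cons x u')
  then show ?thesis using lin_mod_qsh[of xs ys u']
    by (auto intro!: lin_mod_intros simp: qsh_commute[of sA q u'])
qed (simp add: lin_mod_zero module_fsc subspace_Nrel)

lemma lin_mod_bul: "lin_mod sA fsc N (\<lambda>a. bul_w sA q (xs @ [a] @ ys) v)"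
proof (cases v)
  case Nil
  have "bul_w sA q u [] = 0" for u by (cases u) auto
  then show ?thesis by (simp add: Nil lin_mod_zero module_fsc subspace_Nrel)
next
  case (Cons y v')
  show ?thesis
  proof (cases xs)
    case Nil
    show ?thesis
      unfolding Nil Cons
      using lin_mod_comp[OF lin_mod_pcons[of "qsh sA q ys v'"], where \<phi> = "\<lambda>a. a * y"]
      by (simp add: distrib_right scale_mult)
  next
    case (Cons x xs')
    then show ?thesis using lin_mod_qsh[of xs' ys v'] \<open>v = y # v'\<close>
      by (auto intro!: lin_mod_intros)
  qed
qed

lemma ext1_Nrel_lin_mod:
  assumes "\<And>u. lin_mod sA fsc N (\<lambda>a. op a u)" "finsupp f"
  shows "lin_mod sA fsc N (\<lambda>a. ext1 (op a) f)"
  using assms(2)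
proof (induction rule: finsupp_induct)
  case zero
  show ?case by (simp add: lin_zero[OF lin_ext1] lin_mod_zero module_fsc subspace_Nrel)
next
  case (delta u)
  show ?case using assms(1) by simp
next
  case (add g h)
  then show ?case by (simp only: ext1_add lin_mod_intros)
next
  case (scale c g)
  then show ?case by (simp only: ext1_fsc lin_mod_intros)
qed

lemma prec_Nrel_left: "f \<in> N \<Longrightarrow> finsupp g \<Longrightarrow> prec f g \<in> N"
  by (rule lin_Nrel[OF module_fsc subspace_Nrel lin_ext2_left])
    (auto simp: ext2_eq_ext1 intro!: ext1_Nrel_lin_mod lin_mod_prec_left simp del: append.simps)

lemma prec_Nrel_right: "g \<in> N \<Longrightarrow> finsupp f \<Longrightarrow> prec f g \<in> N"
  by (rule lin_Nrel[OF module_fsc subspace_Nrel lin_ext2_right])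
    (auto simp: ext2_eq_ext1' intro!: ext1_Nrel_lin_mod lin_mod_prec_right simp del: append.simps)

lemma bul_Nrel_left: "f \<in> N \<Longrightarrow> finsupp g \<Longrightarrow> bul f g \<in> N"
  by (rule lin_Nrel[OF module_fsc subspace_Nrel lin_ext2_left])
    (auto simp: ext2_eq_ext1 intro!: ext1_Nrel_lin_mod lin_mod_bul simp del: append.simps)

lemma prec_cong:
  assumes "f - f' \<in> N" "g - g' \<in> N" "f' \<in> Fcar" "finsupp f" "finsupp g" "finsupp g'"
  shows "prec f g - prec f' g' \<in> N"
proof -
  have "prec (f - f') g + prec f' (g - g') \<in> N"
    using assms by (intro Nrel.add prec_Nrel_left prec_Nrel_right) (auto simp: Fcar_finsupp)
  then show ?thesis
    using assms by (simp add: ext2_diff_left ext2_diff_right Fcar_finsupp)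
qed

lemma bul_cong:
  assumes "f - f' \<in> N" "g - g' \<in> N" "finsupp f" "finsupp f'" "finsupp g" "finsupp g'"
  shows "bul f g - bul f' g' \<in> N"
proof -
  have "bul (f - f') g + bul (g - g') f' \<in> N"
    using assms by (intro Nrel.add bul_Nrel_left) auto
  then show ?thesis
    using assms by (simp add: ext2_diff_left bul_commute[of g f'] bul_commute[of g' f'])
qed

end

subsection \<open>The derivation\<close>

lemma d_w_Nil [simp]: "d_w lam d0 [] = 0"
  by (simp add: d_w_def fun_eq_iff pointwise)

text \<open>The nonempty sets of positions of \<open>x # xs\<close> are \<open>{0}\<close>, the
  shifts of nonempty sets for \<open>xs\<close>, and these shifts with 0 added. They give the three
  summands, and the added position raises the exponent of \<open>lam\<close> by one. The set
  \<open>{0}\<close> stands apart because its tail part is empty, a set over which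
  \<open>d_w\<close> does not sum.\<close>

lemma d_w_Cons:
  fixes lam :: "'k::comm_ring_1"
  shows "d_w lam d0 (x # xs) =
    delta (d0 x # xs) + pcons x (d_w lam d0 xs) + fsc lam (pcons (d0 x) (d_w lam d0 xs))"
proof
  fix zs
  let ?n = "length xs"
  let ?W = "\<lambda>S xs. map (\<lambda>i. if i \<in> S then d0 (xs ! i) else xs ! i) [0..<length xs]"
  let ?I = "\<lambda>n. {S. S \<subseteq> {..<n} \<and> S \<noteq> {}}"
  let ?c = "\<lambda>S xs. lam ^ (card S - 1) * delta (?W S xs) zs"
  let ?J = "?I ?n"
  let ?T = "insert 0 ` image Suc ` ?J"
  have fin: "finite ?J" by (rule finite_subset[of _ "Pow {..<?n}"]) auto
  have finS: "finite S" if "S \<in> ?J" for S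
    using that finite_subset by auto
  have split: "?I (Suc ?n) = insert {0} (image Suc ` ?J \<union> ?T)" (is "?L = ?R")
  proof (intro set_eqI iffI)
    fix S assume S: "S \<in> ?L"
    define S' where "S' = {i. Suc i \<in> S}"
    have *: "S - {0} = Suc ` S'"
      unfolding S'_def image_iff by (auto simp: image_iff) (metis not0_implies_Suc)
    have sub: "S' \<subseteq> {..<?n}" using S by (auto simp: S'_def)
    show "S \<in> ?R"
    proof (cases "S' = {}")
      case True
      then show ?thesis using * S by auto
    next
      case False
      then have "S' \<in> ?J" using sub by simp
      moreover have "S = Suc ` S' \<or> S = insert 0 (Suc ` S')" using * by auto
      ultimately show ?thesis by blast
    qed
  next
    fix S assume "S \<in> ?R"
    then show "S \<in> ?L" by auto
  qed
  have W_Suc: "?W (Suc ` S) (x # xs) = x # ?W S xs" for S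
    by (simp add: upt_conv_Cons map_Suc_upt[symmetric] image_iff del: upt_Suc map_Suc_upt)
  have W_0: "?W (insert 0 (Suc ` S)) (x # xs) = d0 x # ?W S xs" for S
    by (simp add: upt_conv_Cons map_Suc_upt[symmetric] image_iff del: upt_Suc map_Suc_upt)
  have delta_Cons: "delta (y # ws) zs = (pcons y (delta ws) zs :: 'k)" for y ws
    by simp
  have pcons_sum: "pcons y (d_w lam d0 xs) zs = (\<Sum>S\<in>?J. lam ^ (card S - 1) * pcons y (delta (?W S xs)) zs)" for y
    unfolding d_w_def pcons_def by (auto split: list.splits)
  have inj: "inj_on (image Suc) A" for A
    by (rule inj_onI) (simp add: inj_image_eq_iff)
  have inj0: "inj_on (insert 0) (image Suc ` ?J)"
    by (rule inj_onI) (auto simp: insert_eq_iff)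
  have "d_w lam d0 (x # xs) zs = (\<Sum>S\<in>?I (Suc ?n). ?c S (x # xs))"
    by (simp add: d_w_def)
  also have "\<dots> = ?c {0} (x # xs) + ((\<Sum>S\<in>image Suc ` ?J. ?c S (x # xs)) + (\<Sum>S\<in>?T. ?c S (x # xs)))"
  proof -
    have "{0} \<notin> image Suc ` ?J \<union> ?T" by auto
    moreover have "image Suc ` ?J \<inter> ?T = {}" by auto
    ultimately show ?thesis
      unfolding split using fin by (simp add: sum.union_disjoint)
  qed
  also have "?c {0} (x # xs) = delta (d0 x # xs) zs"
    using W_0[of "{}"] by (simp add: map_nth)
  also have "(\<Sum>S\<in>image Suc ` ?J. ?c S (x # xs)) = pcons x (d_w lam d0 xs) zs"
    unfolding pcons_sum sum.reindex[OF inj] o_def W_Suc delta_Cons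
    by (simp add: card_image)
  also have "(\<Sum>S\<in>?T. ?c S (x # xs)) = lam * pcons (d0 x) (d_w lam d0 xs) zs"
  proof -
    \<comment> \<open>Depends on \<open>S\<close> being nonempty: for \<open>S = {}\<close> the
      truncated subtraction would give 0 on the left and 1 on the right.\<close>
    have "card (insert 0 (Suc ` S)) - 1 = Suc (card S - 1)" if "S \<in> ?J" for S
      using that finS[OF that] by (simp add: card_image card_gt_0_iff)
    then show ?thesis
      unfolding pcons_sum sum.reindex[OF inj0] sum.reindex[OF inj] o_def W_0 delta_Cons sum_distrib_left
      by (intro sum.cong refl) (simp add: mult.assoc)
  qed
  finally show "d_w lam d0 (x # xs) zs = (delta (d0 x # xs) + pcons x (d_w lam d0 xs)
      + fsc lam (pcons (d0 x) (d_w lam d0 xs))) zs"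
    by (simp add: pointwise fsc_def add.assoc)
qed

lemma finsupp_d_w [simp]: "finsupp (d_w lam d0 u)"
  by (induction u) (auto simp: d_w_Cons)

locale comm_diff_algebra = comm_algebra sA q
  for sA :: "'k::comm_ring_1 \<Rightarrow> 'a::comm_ring \<Rightarrow> 'a" and q :: 'k +
  fixes lam :: 'k and d0 :: "'a \<Rightarrow> 'a"
  assumes d0_add: "d0 (a + b) = d0 a + d0 b"
    and d0_scale: "d0 (sA c a) = sA c (d0 a)"
    and d0_mult: "d0 (a * b) = d0 a * b + a * d0 b + sA lam (d0 a * d0 b)"
begin

abbreviation "D \<equiv> ext1 (d_w lam d0)"

lemma finsupp_D [simp]: "finsupp (D f)"
  by (simp add: finsupp_ext1)

lemma D_Fcar [simp]: "D f \<in> Fcar"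
proof -
  have "d_w lam d0 u [] = 0" for u
    by (cases u) (auto simp: d_w_Cons pointwise fsc_def delta_def)
  then have "D f [] = 0" by (simp add: ext1_def)
  then show ?thesis by (simp add: Fcar_iff)
qed

lemma D_pcons:
  assumes "finsupp f"
  shows "D (pcons x f) = pcons (d0 x) f + pcons x (D f) + fsc lam (pcons (d0 x) (D f))"
  by (rule lin_agree[OF module_fsc, where F = "\<lambda>f. D (pcons x f)" and
        G = "\<lambda>f. pcons (d0 x) f + pcons x (D f) + fsc lam (pcons (d0 x) (D f))"])
    (use assms in \<open>auto intro!: lin_intros simp: d_w_Cons\<close>)

text \<open>When the slot is first, its letter occurs as \<open>a\<close> or as \<open>d0 a\<close>,
  and \<open>d0\<close> is linear. A letter in front of the slot is itself differentiated or not,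
  which leaves linearity in \<open>a\<close> untouched.\<close>

lemma lin_mod_d_w: "lin_mod sA fsc N (\<lambda>a. d_w lam d0 (xs @ [a] @ ys))"
proof (induction xs)
  case Nil
  have "lin_mod sA fsc N (\<lambda>a. pcons (d0 a) f)" if "finsupp f" for f
    using d0_add d0_scale by (rule lin_mod_comp[OF lin_mod_pcons[OF that]])
  then show ?case
    using lin_mod_pcons[of "d_w lam d0 ys" sA]
    by (auto simp: d_w_Cons pcons_delta[symmetric] simp del: pcons_delta intro!: lin_mod_intros)
next
  case (Cons x xs)
  then show ?case
    using lin_mod_delta[of sA "d0 x # xs" ys] by (auto simp: d_w_Cons intro!: lin_mod_intros)
qed

lemma D_Nrel: "f \<in> N \<Longrightarrow> D f \<in> N"
  by (rule lin_Nrel[OF module_fsc subspace_Nrel lin_ext1])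
    (auto simp: lin_mod_d_w simp del: append.simps)

lemma D_cong:
  assumes "f - g \<in> N" "finsupp f" "finsupp g"
  shows "D f - D g \<in> N"
  using D_Nrel[OF assms(1)] assms by (simp add: ext1_diff)

section \<open>The derivation identity modulo the relations\<close>

text \<open>The operation is a parameter so that the induction can run through \<open>star\<close>,
  although the axioms name only the other three operations.\<close>

definition defect where
  "defect op f g = D (op f g) - (op (D f) g + op f (D g) + fsc lam (op (D f) (D g)))"

text \<open>A derivation \<open>d\<close> of weight \<open>lam\<close> makes
  \<open>a + lam (d a)\<close> multiplicative in \<open>a\<close>; the prefixes on the right are the
  two parts of this expression for \<open>x\<close>. Since \<open>x\<close> meets no other letter,
  the identity is exact.\<close>

lemma defect_prec_pcons:
  assumes "finsupp f" "finsupp g"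
  shows "defect prec (pcons x f) g =
    pcons x (defect star f g) + fsc lam (pcons (d0 x) (defect star f g))"
  using assms unfolding defect_def
  by (simp add: prec_pcons D_pcons ext2_add_left ext2_fsc_left pcons_add pcons_diff pcons_fsc
      fsc.scale_right_distrib fsc.scale_right_diff_distrib algebra_simps)

text \<open>Here \<open>d0\<close> hits the merged letter \<open>x * y\<close>, and its Leibniz rule
  is a sum of letters in one slot. Splitting that sum costs relations, so the conclusion is a
  membership rather than a formula.\<close>

lemma defect_bul_pcons:
  assumes "finsupp f" "finsupp g" and star: "defect star f g \<in> N"
  shows "defect bul (pcons x f) (pcons y g) \<in> N"
proof -
  \<comment> \<open>The Leibniz rule for \<open>d0 (x * y)\<close>, read as a difference of
    combinations with tail \<open>h\<close>; the rule in the algebra makes it a relation.\<close>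
  define e where "e h = pcons (d0 (x * y)) h -
    (pcons (d0 x * y) h + pcons (x * d0 y) h + fsc lam (pcons (d0 x * d0 y) h))" for h :: "'a list \<Rightarrow> 'k"
  have e: "e h \<in> N" if "finsupp h" for h
  proof -
    have P: "pcons (a + b) h - pcons a h - pcons b h \<in> N" "pcons (sA c a) h - fsc c (pcons a h) \<in> N" for a b c
      using lin_mod_pcons[OF that, of sA] by (auto simp: lin_mod_def)
    have "e h = (pcons (d0 (x * y)) h - pcons (d0 x * y + x * d0 y) h - pcons (sA lam (d0 x * d0 y)) h)
      + (pcons (d0 x * y + x * d0 y) h - pcons (d0 x * y) h - pcons (x * d0 y) h)
      + (pcons (sA lam (d0 x * d0 y)) h - fsc lam (pcons (d0 x * d0 y) h))"
      by (simp add: e_def algebra_simps)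
    also have "\<dots> \<in> N"
      unfolding d0_mult by (intro Nrel.add P)
    finally show ?thesis .
  qed
  have d: "pcons (d0 (x * y)) h = e h + (pcons (d0 x * y) h + pcons (x * d0 y) h +
      fsc lam (pcons (d0 x * d0 y) h))" for h
    by (simp add: e_def)
  let ?s = "defect star f g"
  \<comment> \<open>The two \<open>e\<close> terms come from the two occurrences of
    \<open>d0 (x * y)\<close> in \<open>D_pcons\<close>. The prefixes of \<open>?s\<close> have the
    coefficients of the expanded product of \<open>x + lam (d0 x)\<close> and
    \<open>y + lam (d0 y)\<close>.\<close>
  have "defect bul (pcons x f) (pcons y g) = e (star f g) + fsc lam (e (D (star f g))) +
      (pcons (x * y) ?s + fsc lam (pcons (d0 x * y) ?s + pcons (x * d0 y) ?s +
        fsc lam (pcons (d0 x * d0 y) ?s)))"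
    using assms(1,2) unfolding defect_def
    by (simp add: bul_pcons D_pcons d ext2_add_left ext2_fsc_left ext2_add_right ext2_fsc_right
        pcons_add pcons_diff pcons_fsc
        fsc.scale_right_distrib fsc.scale_right_diff_distrib algebra_simps)
  also have "\<dots> \<in> N"
    using star by (intro Nrel.add Nrel.scal e pcons_Nrel) auto
  finally show ?thesis .
qed

text \<open>The defect is additive in the operation, so that of \<open>star\<close> is the
  combination of the other three plus that of the splitting error \<open>s\<close>. The values of
  \<open>s\<close> on \<open>Fcar\<close>, which contains \<open>D f\<close> and \<open>D g\<close>,
  are relations, and \<open>D\<close> preserves relations.\<close>

lemma defect_star_split:
  assumes "f \<in> Fcar" "g \<in> Fcar" "defect prec f g \<in> N" "defect succ f g \<in> N" "defect bul f g \<in> N"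
  shows "defect star f g \<in> N"
proof -
  define s where "s f g = star f g - (prec f g + succ f g + fsc q (bul f g))" for f g
  have star_eq: "star f g = s f g + (prec f g + succ f g + fsc q (bul f g))" for f g
    by (simp add: s_def)
  have fin_s: "finsupp (s f g)" for f g by (simp add: s_def)
  have s: "s f' g' \<in> N" if "f' \<in> Fcar" "g' \<in> Fcar" for f' g'
    using star_split[OF that] by (simp add: s_def)
  have "defect star f g = defect prec f g + defect succ f g + fsc q (defect bul f g) +
      (D (s f g) - (s (D f) g + s f (D g) + fsc lam (s (D f) (D g))))"
    unfolding defect_def
    by (simp add: star_eq fin_s ext1_add ext1_fsc
        fsc.scale_right_distrib fsc.scale_right_diff_distrib algebra_simps)
  also have "\<dots> \<in> N"
    using assms by (intro Nrel.add Nrel.scal Nrel_diff D_Nrel s) auto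
  finally show ?thesis .
qed

lemma defect_succ: "defect succ f g = defect prec g f"
  by (simp add: defect_def succ_eq_prec add.commute)

text \<open>The rules for the three operations on \<open>u\<close>, \<open>v\<close> follow from the
  rule for \<open>star\<close> on words of smaller total length, possibly empty, and recombine to
  the rule for \<open>star\<close> on \<open>u\<close>, \<open>v\<close>. The empty word is a unit
  for \<open>star\<close> and is killed by \<open>D\<close>.\<close>

lemma defect_star_delta: "defect star (delta u) (delta v) \<in> N"
proof (induction "length u + length v" arbitrary: u v rule: less_induct)
  case less
  have 0: "star 0 f = 0" "star f 0 = 0" for f
    by (rule lin_zero[OF lin_ext2_left]) (rule lin_zero[OF lin_ext2_right])
  show ?case
  proof (cases "u = [] \<or> v = []")
    case True
    then have "defect star (delta u) (delta v) = 0"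
      by (auto simp: defect_def 0 simp del: ext2_delta)
    then show ?thesis by (simp add: Nrel.zero)
  next
    case False
    then obtain x u' y v' where uv: "u = x # u'" "v = y # v'"
      by (meson neq_Nil_conv)
    have IH: "defect star (delta u') (delta v) \<in> N" "defect star (delta v') (delta u) \<in> N"
      "defect star (delta u') (delta v') \<in> N"
      by (rule less; simp add: uv)+
    have "defect prec (delta u) (delta v) \<in> N"
      using defect_prec_pcons[of "delta u'" "delta v" x] IH(1)
      by (simp add: uv Nrel.add Nrel.scal pcons_Nrel)
    moreover have "defect succ (delta u) (delta v) \<in> N"
      using defect_prec_pcons[of "delta v'" "delta u" y] IH(2)
      by (simp add: defect_succ uv Nrel.add Nrel.scal pcons_Nrel)
    moreover have "defect bul (delta u) (delta v) \<in> N"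
      using defect_bul_pcons[of "delta u'" "delta v'" x y] IH(3) by (simp add: uv)
    ultimately show ?thesis
      using False by (intro defect_star_split) auto
  qed
qed

lemma D_prec:
  assumes "f \<in> Fcar" "finsupp g"
  shows "defect prec f g \<in> N"
  unfolding defect_def
proof (rule bilin_agree_mod[OF module_fsc subspace_Nrel, where F = "\<lambda>f g. D (prec f g)" and
      G = "\<lambda>f g. prec (D f) g + prec f (D g) + fsc lam (prec (D f) (D g))"])
  fix u v assume "f u \<noteq> 0"
  then obtain x u' where "u = x # u'"
    using assms(1)[THEN Fcar_Cons] by blast
  then have u: "delta u = pcons x (delta u')" by simp
  have "defect prec (delta u) (delta v) \<in> N"
    unfolding u using defect_star_delta[of u' v]
    by (subst defect_prec_pcons) (auto intro: Nrel.add Nrel.scal pcons_Nrel)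
  then show "D (prec (delta u) (delta v)) - (prec (D (delta u)) (delta v) + prec (delta u) (D (delta v))
      + fsc lam (prec (D (delta u)) (D (delta v)))) \<in> N"
    unfolding defect_def .
qed (use assms in \<open>auto intro!: lin_intros simp: Fcar_finsupp\<close>)

lemma D_bul:
  assumes "f \<in> Fcar" "g \<in> Fcar"
  shows "defect bul f g \<in> N"
  unfolding defect_def
proof (rule bilin_agree_mod[OF module_fsc subspace_Nrel, where F = "\<lambda>f g. D (bul f g)" and
      G = "\<lambda>f g. bul (D f) g + bul f (D g) + fsc lam (bul (D f) (D g))"])
  fix u v assume "f u \<noteq> 0" "g v \<noteq> 0"
  then obtain x u' y v' where "u = x # u'" "v = y # v'"
    using assms[THEN Fcar_Cons] by meson
  then have uv: "delta u = pcons x (delta u')" "delta v = pcons y (delta v')" by auto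
  have "defect bul (delta u) (delta v) \<in> N"
    unfolding uv by (intro defect_bul_pcons defect_star_delta) auto
  then show "D (bul (delta u) (delta v)) - (bul (D (delta u)) (delta v) + bul (delta u) (D (delta v))
      + fsc lam (bul (D (delta u)) (D (delta v)))) \<in> N"
    unfolding defect_def .
qed (use assms in \<open>auto intro!: lin_intros simp: Fcar_finsupp\<close>)

end

subsection \<open>The tensor module as a differential tridendriform algebra\<close>

lemma cls_eq_iff: "cls sA f = cls sA g \<longleftrightarrow> f - g \<in> Nrel sA"
proof
  assume "cls sA f = cls sA g"
  moreover have "f \<in> cls sA f" by (simp add: cls_def Nrel.zero)
  ultimately show "f - g \<in> Nrel sA" by (auto simp: cls_def)
next
  assume fg: "f - g \<in> Nrel sA"
  have "h - f \<in> Nrel sA \<longleftrightarrow> h - g \<in> Nrel sA" for h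
    using Nrel.add[OF _ fg, of "h - f"] Nrel_diff[OF _ fg, of "h - g"] by auto
  then show "cls sA f = cls sA g" by (simp add: cls_def)
qed

lemma rep_cls: "rep (cls sA f) - f \<in> Nrel sA"
proof -
  have "f \<in> cls sA f" by (simp add: cls_def Nrel.zero)
  then have "rep (cls sA f) \<in> cls sA f" unfolding rep_def by (rule someI[of "\<lambda>g. g \<in> cls sA f"])
  then show ?thesis by (simp add: cls_def)
qed

text \<open>Relations have finite support and coefficient 0 at the empty word, so the arbitrary
  choice of a representative never leaves \<open>Fcar\<close>.\<close>

lemma rep_cls_Fcar:
  assumes "f \<in> Fcar"
  shows "rep (cls sA f) \<in> Fcar"
  using Fcar_add[OF Nrel_Fcar[OF rep_cls[of sA f]] assms] by simp

lemma TA_iff: "X \<in> TA sA \<longleftrightarrow> (\<exists>f\<in>Fcar. X = cls sA f)"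
  by (auto simp: TA_def)

lemma cls_TA [simp]: "f \<in> Fcar \<Longrightarrow> cls sA f \<in> TA sA"
  by (auto simp: TA_iff)

lemma addT_cls: "addT sA (cls sA f) (cls sA g) = cls sA (f + g)"
  unfolding addT_def cls_eq_iff
  using Nrel.add[OF rep_cls[of sA f] rep_cls[of sA g]] by (simp add: algebra_simps)

lemma scT_cls: "scT sA c (cls sA f) = cls sA (fsc c f)"
  unfolding scT_def cls_eq_iff
  using Nrel.scal[OF rep_cls[of sA f], of c] by (simp add: fsc.scale_right_diff_distrib)

lemma jA_TA: "jA sA a \<in> TA sA"
  by (simp add: jA_def)

lemma jA_add: "jA sA (a + b) = addT sA (jA sA a) (jA sA b)"
  unfolding jA_def addT_cls cls_eq_iff
  using Nrel.gen_add[of "[]" a b "[]" sA] by (simp add: algebra_simps)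

lemma jA_scale: "jA sA (sA c a) = scT sA c (jA sA a)"
  unfolding jA_def scT_cls cls_eq_iff
  using Nrel.gen_sc[of "[]" sA c a "[]"] by simp

context comm_algebra
begin

lemma precT_cls:
  assumes "f \<in> Fcar" "g \<in> Fcar"
  shows "precT sA q (cls sA f) (cls sA g) = cls sA (prec f g)"
  unfolding precT_def cls_eq_iff
  using assms by (intro prec_cong rep_cls Fcar_finsupp rep_cls_Fcar)

lemma bulT_cls:
  assumes "f \<in> Fcar" "g \<in> Fcar"
  shows "bulT sA q (cls sA f) (cls sA g) = cls sA (bul f g)"
  unfolding bulT_def cls_eq_iff
  using assms by (intro bul_cong rep_cls Fcar_finsupp rep_cls_Fcar)

lemma succT_cls:
  assumes "f \<in> Fcar" "g \<in> Fcar"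
  shows "succT sA q (cls sA f) (cls sA g) = cls sA (succ f g)"
  using precT_cls[OF assms(2,1)] by (simp add: succT_def precT_def succ_eq_prec)

lemma jA_mult: "jA sA (a * b) = bulT sA q (jA sA a) (jA sA b)"
  by (simp add: jA_def bulT_cls)

lemma bilinear_on_TA:
  assumes op: "\<And>f g. f \<in> Fcar \<Longrightarrow> g \<in> Fcar \<Longrightarrow> opT (cls sA f) (cls sA g) = cls sA (ext2 op f g)"
    and Fcar: "\<And>f g. ext2 op f g \<in> Fcar"
  shows "bilinear_on (TA sA) (addT sA) (scT sA) opT"
  unfolding bilinear_on_def TA_def
  by (simp add: op Fcar addT_cls scT_cls ext2_add_left ext2_add_right ext2_fsc_left ext2_fsc_right
      Fcar_finsupp)

text \<open>The axioms spell the product as a sum of three operations, whereas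
  \<open>prec_prec\<close> is stated for \<open>star\<close>. The two are congruent under
  \<open>prec\<close>, and this is where the axioms use the quotient.\<close>

lemma prec_star_split:
  assumes "f \<in> Fcar" "g \<in> Fcar" "h \<in> Fcar"
  shows "cls sA (prec f (prec g h + succ g h + fsc q (bul g h))) = cls sA (prec f (star g h))"
  unfolding cls_eq_iff
proof (rule prec_cong)
  show "prec g h + succ g h + fsc q (bul g h) - star g h \<in> N"
    using Nrel_uminus[OF star_split[OF assms(2,3)]] by simp
qed (use assms in \<open>auto simp: Fcar_finsupp Nrel.zero\<close>)

lemma comm_tridend_on_TA:
  "comm_tridend_on (TA sA) (addT sA) (scT sA) q (precT sA q) (succT sA q) (bulT sA q)"
proof -
  note clsT = precT_cls succT_cls bulT_cls addT_cls scT_cls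
  have axioms: "tridend_on (TA sA) (addT sA) (scT sA) q (precT sA q) (succT sA q) (bulT sA q)"
    unfolding tridend_on_def Let_def
  proof (intro conjI ballI)
    fix X Y Z assume "X \<in> TA sA" "Y \<in> TA sA" "Z \<in> TA sA"
    then obtain f g h where F: "f \<in> Fcar" "g \<in> Fcar" "h \<in> Fcar"
      and XYZ: "X = cls sA f" "Y = cls sA g" "Z = cls sA h"
      by (auto simp: TA_iff)
    note fin = F[THEN Fcar_finsupp]
    let ?st = "\<lambda>x y. addT sA (addT sA (precT sA q x y) (succT sA q x y)) (scT sA q (bulT sA q x y))"
    show "precT sA q (precT sA q X Y) Z = precT sA q X (?st Y Z)"
      using F fin by (simp add: XYZ clsT prec_prec prec_star_split)
    show "precT sA q (succT sA q X Y) Z = succT sA q X (precT sA q Y Z)"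
      using F fin by (simp add: XYZ clsT succ_eq_prec prec_prec star_commute)
    \<comment> \<open>Exchanging arguments turns this into the first axiom for \<open>h\<close>,
      \<open>g\<close>, \<open>f\<close>, read from right to left.\<close>
    show "succT sA q (?st X Y) Z = succT sA q X (succT sA q Y Z)"
      using F fin prec_star_split[of h f g]
      by (simp add: XYZ clsT succ_eq_prec prec_prec star_commute)
    show "bulT sA q (succT sA q X Y) Z = succT sA q X (bulT sA q Y Z)"
      using F fin by (simp add: XYZ clsT succ_eq_prec prec_bul bul_commute[of _ h])
    \<comment> \<open>Both sides are represented by \<open>prec (bul f h) g\<close>, once
      \<open>bul\<close> is commuted.\<close>
    show "bulT sA q (precT sA q X Y) Z = bulT sA q X (succT sA q Y Z)"
      using F fin prec_bul[of h f g] prec_bul[of f h g]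
      by (simp add: XYZ clsT succ_eq_prec bul_commute[of _ h])
    show "precT sA q (bulT sA q X Y) Z = bulT sA q X (precT sA q Y Z)"
      using F fin by (simp add: XYZ clsT prec_bul)
    show "bulT sA q (bulT sA q X Y) Z = bulT sA q X (bulT sA q Y Z)"
      using F by (simp add: XYZ clsT bul_assoc)
  qed (rule bilinear_on_TA[OF precT_cls] bilinear_on_TA[OF succT_cls] bilinear_on_TA[OF bulT_cls];
      simp)+
  moreover have "succT sA q X Y = precT sA q Y X \<and> bulT sA q X Y = bulT sA q Y X"
    if "X \<in> TA sA" "Y \<in> TA sA" for X Y
    using that by (auto simp: TA_iff clsT succ_eq_prec bul_commute)
  ultimately show ?thesis by (simp add: comm_tridend_on_def)
qed

end

context comm_diff_algebra
begin

lemma dTA_cls: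
  assumes "f \<in> Fcar"
  shows "dTA sA lam d0 (cls sA f) = cls sA (D f)"
  unfolding dTA_def cls_eq_iff
  using assms by (intro D_cong rep_cls Fcar_finsupp rep_cls_Fcar)

lemma dTA_jA: "dTA sA lam d0 (jA sA a) = jA sA (d0 a)"
proof -
  have "fsc lam (0 :: 'a list \<Rightarrow> 'k) = 0" by (rule fsc.scale_zero_right)
  then show ?thesis by (simp add: jA_def dTA_cls d_w_Cons)
qed

lemma derivation_on_TA:
  assumes op: "\<And>f g. f \<in> Fcar \<Longrightarrow> g \<in> Fcar \<Longrightarrow> opT (cls sA f) (cls sA g) = cls sA (ext2 op f g)"
    and Fcar: "\<And>f g. ext2 op f g \<in> Fcar"
    and defect: "\<And>f g. f \<in> Fcar \<Longrightarrow> g \<in> Fcar \<Longrightarrow> defect (ext2 op) f g \<in> N"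
  shows "derivation_on (TA sA) (addT sA) (scT sA) lam opT (dTA sA lam d0)"
  unfolding derivation_on_def TA_def
  using defect by (simp add: op Fcar dTA_cls addT_cls scT_cls cls_eq_iff defect_def)

lemma comm_diff_tridend_on_TA:
  "comm_diff_tridend_on (TA sA) (addT sA) (scT sA) q lam
    (precT sA q) (succT sA q) (bulT sA q) (dTA sA lam d0)"
proof -
  have "linear_on (TA sA) (addT sA) (scT sA) (dTA sA lam d0)"
    unfolding linear_on_def TA_def
    by (simp add: dTA_cls addT_cls scT_cls ext1_add ext1_fsc Fcar_finsupp)
  moreover have "derivation_on (TA sA) (addT sA) (scT sA) lam (precT sA q) (dTA sA lam d0)"
    by (rule derivation_on_TA[OF precT_cls]) (simp_all add: D_prec Fcar_finsupp)
  moreover have "derivation_on (TA sA) (addT sA) (scT sA) lam (succT sA q) (dTA sA lam d0)"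
    by (rule derivation_on_TA[OF succT_cls]) (simp_all add: defect_succ D_prec Fcar_finsupp)
  moreover have "derivation_on (TA sA) (addT sA) (scT sA) lam (bulT sA q) (dTA sA lam d0)"
    by (rule derivation_on_TA[OF bulT_cls]) (simp_all add: D_bul)
  ultimately show ?thesis
    unfolding comm_diff_tridend_on_def
    using comm_tridend_on_TA by blast
qed

end


subsection \<open>The universal property\<close>

text \<open>The target need not contain an \<open>e\<close> with
  \<open>pr (psi x) e = psi x\<close>, so one-letter words have their own clause. The 0 at
  \<open>[]\<close> is a default value: elements of \<open>Fcar\<close> have coefficient 0
  there.\<close>

fun word_map :: "('t \<Rightarrow> 't \<Rightarrow> 't) \<Rightarrow> ('a \<Rightarrow> 't) \<Rightarrow> 'a list \<Rightarrow> 't::zero" where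
  "word_map pr psi [] = 0"
| "word_map pr psi [x] = psi x"
| "word_map pr psi (x # y # w) = pr (psi x) (word_map pr psi (y # w))"

lemma word_map_Cons: "w \<noteq> [] \<Longrightarrow> word_map pr psi (x # w) = pr (psi x) (word_map pr psi w)"
  by (cases w) auto

locale tridend_extension = comm_diff_algebra sA q lam d0
  for sA :: "'k::comm_ring_1 \<Rightarrow> 'a::comm_ring \<Rightarrow> 'a" and q lam :: 'k and d0 :: "'a \<Rightarrow> 'a" +
  fixes sT :: "'k \<Rightarrow> 't::ab_group_add \<Rightarrow> 't"
    and pr su bu :: "'t \<Rightarrow> 't \<Rightarrow> 't" and dT :: "'t \<Rightarrow> 't" and psi :: "'a \<Rightarrow> 't"
  assumes module_T: "module sT"
    and tridend_T: "comm_diff_tridend_on UNIV (+) sT q lam pr su bu dT"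
    and psi_add: "psi (a + b) = psi a + psi b"
    and psi_scale: "psi (sA c a) = sT c (psi a)"
    and psi_mult: "psi (a * b) = bu (psi a) (psi b)"
    and psi_d: "dT (psi a) = psi (d0 a)"
begin

lemma
  shows pr_add_left: "pr (x + y) z = pr x z + pr y z"
    and pr_add_right: "pr x (y + z) = pr x y + pr x z"
    and pr_scale_left: "pr (sT c x) y = sT c (pr x y)"
    and pr_scale_right: "pr x (sT c y) = sT c (pr x y)"
    and bu_add_left: "bu (x + y) z = bu x z + bu y z"
    and bu_add_right: "bu x (y + z) = bu x y + bu x z"
    and bu_scale_left: "bu (sT c x) y = sT c (bu x y)"
    and bu_scale_right: "bu x (sT c y) = sT c (bu x y)"
    and pr_pr: "pr (pr x y) z = pr x (pr y z + su y z + sT q (bu y z))"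
    and pr_bu: "pr (bu x y) z = bu x (pr y z)"
    and su_eq_pr: "su x y = pr y x"
    and bu_comm: "bu x y = bu y x"
    and dT_add: "dT (x + y) = dT x + dT y"
    and dT_scale: "dT (sT c x) = sT c (dT x)"
    and dT_pr: "dT (pr x y) = pr (dT x) y + pr x (dT y) + sT lam (pr (dT x) (dT y))"
  using tridend_T
  unfolding comm_diff_tridend_on_def comm_tridend_on_def tridend_on_def bilinear_on_def
    linear_on_def derivation_on_def Let_def
  by (simp_all only: UNIV_I ball_UNIV)

abbreviation "ext \<equiv> lext sT (word_map pr psi)"

lemma lin_ext: "lin sT ext"
  by (rule lin_lext[OF module_T])

lemma ext_delta [simp]: "ext (delta u) = word_map pr psi u"
  by (rule lext_delta[OF module_T])

lemmas ext_add = lin_plus[OF lin_ext]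
lemmas ext_diff = lin_minus[OF lin_ext]
lemmas ext_fsc = lin_scale[OF lin_ext]

text \<open>At the empty word the two sides would be \<open>psi x\<close> and 0, hence the
  restriction to \<open>Fcar\<close>.\<close>

lemma ext_pcons:
  assumes "f \<in> Fcar"
  shows "ext (pcons x f) = pr (psi x) (ext f)"
proof (rule lin_agree[OF module_T, where F = "\<lambda>f. ext (pcons x f)" and G = "\<lambda>f. pr (psi x) (ext f)"])
  show "lin sT (\<lambda>f. ext (pcons x f))"
    by (rule lin_compose[OF lin_ext lin_pcons]) simp
  show "lin sT (\<lambda>f. pr (psi x) (ext f))"
    by (rule linI) (simp_all add: ext_add ext_fsc pr_add_right pr_scale_right)
  show "ext (pcons x (delta u)) = pr (psi x) (ext (delta u))" if "f u \<noteq> 0" for u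
    using Fcar_Cons[OF assms that] by (auto simp: word_map_Cons)
qed (use assms in \<open>simp add: Fcar_finsupp\<close>)

lemma lin_mod_word_map: "lin_mod sA sT {0} (\<lambda>a. word_map pr psi (xs @ [a] @ ys))"
proof (induction xs)
  case Nil
  show ?case
    by (cases ys) (simp_all add: lin_mod_def psi_add psi_scale pr_add_left pr_scale_left)
next
  case (Cons x xs)
  then show ?case
    by (simp add: lin_mod_def word_map_Cons diff_diff_eq pr_add_right[symmetric] pr_scale_right[symmetric])
qed

lemma ext_Nrel:
  assumes "f \<in> N"
  shows "ext f = 0"
proof -
  have "ext f \<in> {0}"
    by (rule lin_Nrel[OF module_T module.subspace_single_0[OF module_T] lin_ext _ assms])
      (use lin_mod_word_map in \<open>simp del: append.simps\<close>)
  then show ?thesis by simp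
qed

section \<open>Multiplicativity of the extension\<close>

lemma ext_star_split:
  assumes "f \<in> Fcar" "g \<in> Fcar"
  shows "ext (star f g) = ext (prec f g) + ext (succ f g) + sT q (ext (bul f g))"
proof -
  have "ext (star f g - (prec f g + succ f g + fsc q (bul f g))) = 0"
    using star_split[OF assms] by (rule ext_Nrel)
  then show ?thesis by (simp add: ext_diff ext_add ext_fsc)
qed

text \<open>The tail \<open>u\<close> is multiplied with \<open>v\<close>, and \<open>pr_pr\<close>
  read from right to left reassembles \<open>x # u\<close>. An empty tail has no image in the
  target, so the formula for \<open>star\<close> is assumed only for nonempty \<open>u\<close>.
  Keeping it as an assumption lets the lemma serve inside the induction for \<open>star\<close> and
  again after it.\<close>

lemma ext_prec_Cons:
  assumes "v \<noteq> []"
    and star: "u \<noteq> [] \<Longrightarrow> ext (star (delta u) (delta v)) = pr (ext (delta u)) (ext (delta v)) +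
      su (ext (delta u)) (ext (delta v)) + sT q (bu (ext (delta u)) (ext (delta v)))"
  shows "ext (prec (delta (x # u)) (delta v)) = pr (ext (delta (x # u))) (ext (delta v))"
proof (cases "u = []")
  case True
  then show ?thesis using assms(1) by (simp add: word_map_Cons)
next
  case False
  have "prec (delta (x # u)) (delta v) = pcons x (star (delta u) (delta v))"
    by simp
  then have "ext (prec (delta (x # u)) (delta v)) = pr (psi x) (ext (star (delta u) (delta v)))"
    using False by (simp add: ext_pcons star_Fcar del: ext2_delta)
  also have "\<dots> = pr (ext (delta (x # u))) (ext (delta v))"
    unfolding star[OF False] using False by (simp add: word_map_Cons pr_pr)
  finally show ?thesis .
qed

lemma ext_bul_Cons:
  assumes star: "u \<noteq> [] \<Longrightarrow> v \<noteq> [] \<Longrightarrow> ext (star (delta u) (delta v)) =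
      pr (ext (delta u)) (ext (delta v)) +
      su (ext (delta u)) (ext (delta v)) + sT q (bu (ext (delta u)) (ext (delta v)))"
  shows "ext (bul (delta (x # u)) (delta (y # v))) = bu (ext (delta (x # u))) (ext (delta (y # v)))"
proof -
  consider "u = []" "v = []" | "u = []" "v \<noteq> []" | "u \<noteq> []" "v = []" | "u \<noteq> []" "v \<noteq> []"
    by blast
  then show ?thesis
  proof cases
    case 1
    then show ?thesis by (simp add: psi_mult)
  next
    case 2
    then show ?thesis by (simp add: word_map_Cons psi_mult pr_bu)
  next
    case 3
    then show ?thesis
      by (simp add: word_map_Cons psi_mult) (metis bu_comm pr_bu)
  next
    case 4
    have "bul (delta (x # u)) (delta (y # v)) = pcons (x * y) (star (delta u) (delta v))"
      by simp
    then have "ext (bul (delta (x # u)) (delta (y # v))) =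
        pr (psi (x * y)) (ext (star (delta u) (delta v)))"
      using 4 by (simp add: ext_pcons star_Fcar del: ext2_delta)
    also have "\<dots> = pr (pr (bu (psi x) (psi y)) (ext (delta u))) (ext (delta v))"
      unfolding star[OF 4] psi_mult pr_pr ..
    \<comment> \<open>\<open>pr_bu\<close> attaches a tail to the right factor of a
      \<open>bu\<close> product; \<open>bu_comm\<close> brings \<open>psi x\<close> there for
      \<open>u\<close>, then \<open>psi y\<close> for \<open>v\<close>.\<close>
    also have "\<dots> = bu (pr (psi x) (ext (delta u))) (pr (psi y) (ext (delta v)))"
      by (metis bu_comm pr_bu)
    finally show ?thesis using 4 by (simp add: word_map_Cons)
  qed
qed

text \<open>The three operations on \<open>u\<close>, \<open>v\<close> involve \<open>star\<close>
  products of smaller total length, known by induction when both factors are nonempty. Their images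
  add up to that of \<open>star\<close> because the extension vanishes on relations.\<close>

lemma ext_star_delta:
  assumes "u \<noteq> []" "v \<noteq> []"
  shows "ext (star (delta u) (delta v)) = pr (ext (delta u)) (ext (delta v)) +
    su (ext (delta u)) (ext (delta v)) + sT q (bu (ext (delta u)) (ext (delta v)))"
  using assms
proof (induction "length u + length v" arbitrary: u v rule: less_induct)
  case less
  then obtain x u' y v' where uv: "u = x # u'" "v = y # v'"
    by (meson neq_Nil_conv)
  have "ext (prec (delta u) (delta v)) = pr (ext (delta u)) (ext (delta v))"
    unfolding uv(1) by (rule ext_prec_Cons) (use less uv in auto)
  moreover have "ext (succ (delta u) (delta v)) = su (ext (delta u)) (ext (delta v))"
    unfolding succ_eq_prec su_eq_pr uv(2) by (rule ext_prec_Cons) (use less uv in auto)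
  moreover have "ext (bul (delta u) (delta v)) = bu (ext (delta u)) (ext (delta v))"
    unfolding uv by (rule ext_bul_Cons) (use less uv in auto)
  ultimately show ?case
    using less.prems by (subst ext_star_split) simp_all
qed

lemma ext_prec:
  assumes "f \<in> Fcar" "g \<in> Fcar"
  shows "ext (prec f g) = pr (ext f) (ext g)"
proof (rule bilin_agree[OF module_T, where F = "\<lambda>f g. ext (prec f g)" and
      G = "\<lambda>f g. pr (ext f) (ext g)"])
  fix u v assume "f u \<noteq> 0" "g v \<noteq> 0"
  then obtain x u' y v' where "u = x # u'" "v = y # v'"
    using assms[THEN Fcar_Cons] by meson
  then show "ext (prec (delta u) (delta v)) = pr (ext (delta u)) (ext (delta v))"
    using ext_prec_Cons[OF _ ext_star_delta] by blast
qed (use assms in \<open>auto intro!: linI simp: Fcar_finsupp ext2_add_left ext2_add_right ext2_fsc_left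
    ext2_fsc_right ext_add ext_fsc pr_add_left pr_add_right pr_scale_left pr_scale_right\<close>)

lemma ext_bul:
  assumes "f \<in> Fcar" "g \<in> Fcar"
  shows "ext (bul f g) = bu (ext f) (ext g)"
proof (rule bilin_agree[OF module_T, where F = "\<lambda>f g. ext (bul f g)" and
      G = "\<lambda>f g. bu (ext f) (ext g)"])
  fix u v assume "f u \<noteq> 0" "g v \<noteq> 0"
  then obtain x u' y v' where "u = x # u'" "v = y # v'"
    using assms[THEN Fcar_Cons] by meson
  then show "ext (bul (delta u) (delta v)) = bu (ext (delta u)) (ext (delta v))"
    using ext_bul_Cons[OF ext_star_delta] by blast
qed (use assms in \<open>auto intro!: linI simp: Fcar_finsupp ext2_add_left ext2_add_right ext2_fsc_left
    ext2_fsc_right ext_add ext_fsc bu_add_left bu_add_right bu_scale_left bu_scale_right\<close>)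

section \<open>Compatibility of the extension with the derivations\<close>

text \<open>\<open>D\<close> on \<open>x # u\<close> and \<open>dT\<close> on
  \<open>pr (psi x) (word_map pr psi u)\<close> expand into the same three terms, matched by
  \<open>psi_d\<close>. For a one-letter word only the term with letter \<open>d0 x\<close>
  survives.\<close>

lemma ext_D_delta: "u \<noteq> [] \<Longrightarrow> ext (D (delta u)) = dT (ext (delta u))"
proof (induction u)
  case (Cons x u)
  show ?case
  proof (cases "u = []")
    case True
    then show ?thesis
      by (simp add: d_w_Cons ext_add ext_fsc lin_zero[OF lin_ext] psi_d
          module.scale_zero_right[OF module_T])
  next
    case False
    have "D (delta (x # u)) = pcons (d0 x) (delta u) + pcons x (D (delta u)) +
        fsc lam (pcons (d0 x) (D (delta u)))"
      by (simp add: d_w_Cons)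
    moreover have "ext (pcons z (delta u)) = pr (psi z) (ext (delta u))"
      "ext (pcons z (D (delta u))) = pr (psi z) (dT (ext (delta u)))" for z
      using False Cons.IH by (simp_all add: ext_pcons word_map_Cons del: ext1_delta)
    ultimately show ?thesis
      using False
      by (simp add: ext_add ext_fsc word_map_Cons dT_pr psi_d del: ext1_delta pcons_delta)
  qed
qed simp

lemma ext_D:
  assumes "f \<in> Fcar"
  shows "ext (D f) = dT (ext f)"
proof (rule lin_agree[OF module_T, where F = "\<lambda>f. ext (D f)" and G = "\<lambda>f. dT (ext f)"])
  show "ext (D (delta u)) = dT (ext (delta u))" if "f u \<noteq> 0" for u
    using Fcar_Cons[OF assms that] by (intro ext_D_delta) auto
qed (use assms in \<open>auto intro!: linI simp: Fcar_finsupp ext1_add ext1_fsc ext_add ext_fsc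
    dT_add dT_scale\<close>)

section \<open>Passage to classes and uniqueness\<close>

definition ext_TA where "ext_TA X = ext (rep X)"

lemma ext_TA_cls:
  assumes "f \<in> Fcar"
  shows "ext_TA (cls sA f) = ext f"
proof -
  have "ext (rep (cls sA f) - f) = 0"
    using rep_cls by (rule ext_Nrel)
  then show ?thesis
    using assms by (simp add: ext_TA_def ext_diff rep_cls_Fcar Fcar_finsupp)
qed

lemma ext_TA_hom:
  shows "\<forall>X\<in>TA sA. \<forall>Y\<in>TA sA. ext_TA (addT sA X Y) = ext_TA X + ext_TA Y"
    and "\<forall>c. \<forall>X\<in>TA sA. ext_TA (scT sA c X) = sT c (ext_TA X)"
    and "\<forall>X\<in>TA sA. \<forall>Y\<in>TA sA. ext_TA (precT sA q X Y) = pr (ext_TA X) (ext_TA Y)"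
    and "\<forall>X\<in>TA sA. \<forall>Y\<in>TA sA. ext_TA (succT sA q X Y) = su (ext_TA X) (ext_TA Y)"
    and "\<forall>X\<in>TA sA. \<forall>Y\<in>TA sA. ext_TA (bulT sA q X Y) = bu (ext_TA X) (ext_TA Y)"
    and "\<forall>X\<in>TA sA. dT (ext_TA X) = ext_TA (dTA sA lam d0 X)"
    and "\<forall>a. ext_TA (jA sA a) = psi a"
  unfolding TA_def
  by (simp_all add: addT_cls scT_cls precT_cls succT_cls bulT_cls dTA_cls jA_def ext_TA_cls
      ext_add ext_fsc ext_prec ext_bul ext_D succ_eq_prec su_eq_pr Fcar_finsupp)

lemma ext_TA_unique:
  assumes add: "\<And>X Y. X \<in> TA sA \<Longrightarrow> Y \<in> TA sA \<Longrightarrow> F (addT sA X Y) = F X + F Y"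
    and scale: "\<And>c X. X \<in> TA sA \<Longrightarrow> F (scT sA c X) = sT c (F X)"
    and prec: "\<And>X Y. X \<in> TA sA \<Longrightarrow> Y \<in> TA sA \<Longrightarrow> F (precT sA q X Y) = pr (F X) (F Y)"
    and j: "\<And>a. F (jA sA a) = psi a"
    and X: "X \<in> TA sA"
  shows "F X = ext_TA X"
proof -
  have words: "F (cls sA (delta u)) = word_map pr psi u" if "u \<noteq> []" for u
    using that
  proof (induction u)
    case (Cons x u)
    show ?case
    proof (cases "u = []")
      case True
      then show ?thesis using j[of x] by (simp add: jA_def)
    next
      case False
      then have "cls sA (delta (x # u)) = precT sA q (jA sA x) (cls sA (delta u))"
        by (simp add: jA_def precT_cls)
      then show ?thesis
        using False Cons.IH by (simp add: prec j jA_TA word_map_Cons)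
    qed
  qed simp
  have "F (cls sA f) = ext f" if "f \<in> Fcar" for f
    using that
  proof (induction rule: Fcar_induct)
    case zero
    \<comment> \<open>The zero class is a multiple of itself by the scalar 0, so homogeneity
      determines the value of \<open>F\<close> there.\<close>
    have "F (scT sA 0 (cls sA 0)) = 0"
      by (simp add: scale module.scale_zero_left[OF module_T])
    then show ?case by (simp add: scT_cls lin_zero[OF lin_ext])
  next
    case (delta u)
    then show ?case by (simp add: words)
  next
    case (add f g)
    then show ?case
      using assms(1)[of "cls sA f" "cls sA g"] by (simp add: addT_cls ext_add Fcar_finsupp)
  next
    case (scale c f)
    then show ?case using assms(2)[of "cls sA f" c] by (simp add: scT_cls ext_fsc Fcar_finsupp)
  qed
  then show ?thesis using X by (auto simp: TA_iff ext_TA_cls)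
qed

end

theorem theorem4p4:
  fixes sA :: "'k::comm_ring_1 \<Rightarrow> 'a::comm_ring \<Rightarrow> 'a"
    and lam q :: 'k
    and d0 :: "'a \<Rightarrow> 'a"
  assumes "comm_diff_alg sA lam d0"
  shows
    "comm_diff_tridend_on (TA sA) (addT sA) (scT sA) q lam
        (precT sA q) (succT sA q) (bulT sA q) (dTA sA lam d0)
     \<and> (\<forall>a. jA sA a \<in> TA sA)
     \<and> (\<forall>a b. jA sA (a + b) = addT sA (jA sA a) (jA sA b))
     \<and> (\<forall>c a. jA sA (sA c a) = scT sA c (jA sA a))
     \<and> (\<forall>a b. jA sA (a * b) = bulT sA q (jA sA a) (jA sA b))
     \<and> (\<forall>a. dTA sA lam d0 (jA sA a) = jA sA (d0 a))
     \<and> (\<forall>(sT :: 'k \<Rightarrow> 't::ab_group_add \<Rightarrow> 't) prT suT buT dT (psi :: 'a \<Rightarrow> 't).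
          module sT
          \<and> comm_diff_tridend_on UNIV (+) sT q lam prT suT buT dT
          \<and> (\<forall>a b. psi (a + b) = psi a + psi b)
          \<and> (\<forall>c a. psi (sA c a) = sT c (psi a))
          \<and> (\<forall>a b. psi (a * b) = buT (psi a) (psi b))
          \<and> (\<forall>a. dT (psi a) = psi (d0 a))
          \<longrightarrow>
          (\<exists>psib. (let P = (\<lambda>f.
                (\<forall>X\<in>TA sA. \<forall>Y\<in>TA sA. f (addT sA X Y) = f X + f Y)
              \<and> (\<forall>c. \<forall>X\<in>TA sA. f (scT sA c X) = sT c (f X))
              \<and> (\<forall>X\<in>TA sA. \<forall>Y\<in>TA sA. f (precT sA q X Y) = prT (f X) (f Y))
              \<and> (\<forall>X\<in>TA sA. \<forall>Y\<in>TA sA. f (succT sA q X Y) = suT (f X) (f Y))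
              \<and> (\<forall>X\<in>TA sA. \<forall>Y\<in>TA sA. f (bulT sA q X Y) = buT (f X) (f Y))
              \<and> (\<forall>X\<in>TA sA. dT (f X) = f (dTA sA lam d0 X))
              \<and> (\<forall>a. f (jA sA a) = psi a))
             in P psib \<and> (\<forall>f. P f \<longrightarrow> (\<forall>X\<in>TA sA. f X = psib X)))))"
proof -
  interpret comm_diff_algebra sA q lam d0
    using assms unfolding comm_diff_alg_def
    by (intro comm_diff_algebra.intro comm_algebra.intro comm_diff_algebra_axioms.intro) blast+
  show ?thesis
  proof (intro conjI allI impI)
    fix sT :: "'k \<Rightarrow> 't \<Rightarrow> 't" and prT suT buT :: "'t \<Rightarrow> 't \<Rightarrow> 't" and dT :: "'t \<Rightarrow> 't"
      and psi :: "'a \<Rightarrow> 't"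
    assume "module sT
          \<and> comm_diff_tridend_on UNIV (+) sT q lam prT suT buT dT
          \<and> (\<forall>a b. psi (a + b) = psi a + psi b)
          \<and> (\<forall>c a. psi (sA c a) = sT c (psi a))
          \<and> (\<forall>a b. psi (a * b) = buT (psi a) (psi b))
          \<and> (\<forall>a. dT (psi a) = psi (d0 a))"
    then interpret T: tridend_extension sA q lam d0 sT prT suT buT dT psi
      by (intro tridend_extension.intro comm_diff_algebra_axioms tridend_extension_axioms.intro) blast+
    show "\<exists>psib. (let P = (\<lambda>f.
                (\<forall>X\<in>TA sA. \<forall>Y\<in>TA sA. f (addT sA X Y) = f X + f Y)
              \<and> (\<forall>c. \<forall>X\<in>TA sA. f (scT sA c X) = sT c (f X))
              \<and> (\<forall>X\<in>TA sA. \<forall>Y\<in>TA sA. f (precT sA q X Y) = prT (f X) (f Y))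
              \<and> (\<forall>X\<in>TA sA. \<forall>Y\<in>TA sA. f (succT sA q X Y) = suT (f X) (f Y))
              \<and> (\<forall>X\<in>TA sA. \<forall>Y\<in>TA sA. f (bulT sA q X Y) = buT (f X) (f Y))
              \<and> (\<forall>X\<in>TA sA. dT (f X) = f (dTA sA lam d0 X))
              \<and> (\<forall>a. f (jA sA a) = psi a))
             in P psib \<and> (\<forall>f. P f \<longrightarrow> (\<forall>X\<in>TA sA. f X = psib X)))"
      unfolding Let_def
    proof (intro exI[of _ T.ext_TA] conjI T.ext_TA_hom allI impI ballI, elim conjE)
      fix f X
      assume "\<forall>X\<in>TA sA. \<forall>Y\<in>TA sA. f (addT sA X Y) = f X + f Y"
        "\<forall>c. \<forall>X\<in>TA sA. f (scT sA c X) = sT c (f X)"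
        "\<forall>X\<in>TA sA. \<forall>Y\<in>TA sA. f (precT sA q X Y) = prT (f X) (f Y)"
        "\<forall>a. f (jA sA a) = psi a" "X \<in> TA sA"
      then show "f X = T.ext_TA X"
        by (intro T.ext_TA_unique) simp_all
    qed
  qed (rule comm_diff_tridend_on_TA jA_TA jA_add jA_scale jA_mult dTA_jA)+
qed

end
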